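(* Let $\mathfrak{g}$ be a non-abelian four-dimensional real Lie algebra. Then $\mathfrak{g}$ possesses an integrable Born structure $(h,J,\mathfrak{g}_\pm)$ if and only if $\mathfrak{g}$ is isomorphic to one of the following Lie algebras: $$\mathfrak{rh}_3,\ \mathfrak{rr}_{3,0},\ \mathfrak{r}_2\mathfrak{r}_2,\ \mathfrak{r}'_2,\ \mathfrak{r}_{4,-1,-1},\ \mathfrak{d}_{4,1},\ \mathfrak{d}_{4,2},\ \mathfrak{d}_{4,1/2}.$$
   Context: All Lie algebras are real and finite-dimensional. A pseudo-Riemannian metric on a Lie algebra is a non-degenerate symmetric bilinear form of arbitrary signature. Born structures. For non-degenerate bilinear forms $a,b$ on a vector space, the recursion operator from $a$ to $b$ is the unique invertible endomorphism $A$ with $a(A\cdot,\cdot)=b(\cdot,\cdot)$. A Born structure on a Lie algebra $\mathfrak{g}$ is a triple $(g,h,\omega)$ of two pseudo-Riemannian metrics $g,h$ and a non-degenerate two-form $\omega$ such that the recursion operators $A$ from $g$ to $\omega$, $B$ from $g$ to $h$ and $-J$ from $\omega$ to $h$ satisfy $A^2=B^2=-J^2=\mathrm{Id}$. It is integrable if $\omega$ is closed under the Chevalley–Eilenberg differential, the Nijenhuis tensor of $J$ vanishes, and the $\pm1$-eigenspaces of $A$ are subalgebras. A Born structure is equivalently encoded as $(h,J,\mathfrak{g}_\pm)$, where $J^2=-\mathrm{Id}$, $h(J\cdot,J\cdot)=h$, and $\mathfrak{g}=\mathfrak{g}_+\oplus\mathfrak{g}_-$ is an $h$-orthogonal splitting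 whose summands (the $\pm1$-eigenspaces of $A$) are interchanged by $J$; then $\omega=h(J\cdot,\cdot)$ and $g=\omega(A\cdot,\cdot)$. The listed Lie algebras have a basis $e_1,e_2,e_3,e_4$ with the following non-zero brackets (up to antisymmetry): - $\mathfrak{rh}_3$: $[e_1,e_2]=e_3$. - $\mathfrak{rr}_{3,0}$: $[e_1,e_2]=e_2$. - $\mathfrak{r}_2\mathfrak{r}_2$: $[e_1,e_2]=e_2$, $[e_3,e_4]=e_4$. - $\mathfrak{r}'_2$: $[e_1,e_3]=e_3$, $[e_1,e_4]=e_4$, $[e_2,e_3]=e_4$, $[e_2,e_4]=-e_3$. - $\mathfrak{r}_{4,-1,-1}$: $[e_1,e_4]=-e_1$, $[e_2,e_4]=e_2$, $[e_3,e_4]=e_3$. - $\mathfrak{d}_{4,1}$: $[e_1,e_2]=e_3$, $[e_1,e_4]=-e_1$, $[e_3,e_4]=-e_3$. - $\mathfrak{d}_{4,2}$: $[e_1,e_2]=e_3$, $[e_1,e_4]=-2e_1$, $[e_2,e_4]=e_2$, $[e_3,e_4]=-e_3$. - $\mathfrak{d}_{4,1/2}$: $[e_1,e_2]=e_3$, $[e_1,e_4]=-\tfrac12e_1$, $[e_2,e_4]=-\tfrac12e_2$, $[e_3,e_4]=-e_3$. *)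

theory Defs
  imports "HOL-Analysis.Analysis"
begin

section \<open>Lie algebras\<close>

definition lie_algebra :: "('a::real_vector \<Rightarrow> 'a \<Rightarrow> 'a) \<Rightarrow> bool" where
  "lie_algebra br \<longleftrightarrow> bilinear br \<and> (\<forall>x. br x x = 0) \<and>
     (\<forall>x y z. br x (br y z) + br y (br z x) + br z (br x y) = 0)"

definition abelian_lie :: "('a::real_vector \<Rightarrow> 'a \<Rightarrow> 'a) \<Rightarrow> bool" where
  "abelian_lie br \<longleftrightarrow> (\<forall>x y. br x y = 0)"

definition lie_subalgebra :: "('a::real_vector \<Rightarrow> 'a \<Rightarrow> 'a) \<Rightarrow> 'a set \<Rightarrow> bool" where
  "lie_subalgebra br S \<longleftrightarrow> subspace S \<and> (\<forall>x\<in>S. \<forall>y\<in>S. br x y \<in> S)"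

definition lie_isomorphic ::
  "('a::real_vector \<Rightarrow> 'a \<Rightarrow> 'a) \<Rightarrow> ('b::real_vector \<Rightarrow> 'b \<Rightarrow> 'b) \<Rightarrow> bool" where
  "lie_isomorphic br br' \<longleftrightarrow>
     (\<exists>f. linear f \<and> bij f \<and> (\<forall>x y. f (br x y) = br' (f x) (f y)))"

section \<open>Born structures\<close>

definition nondegenerate :: "('a::real_vector \<Rightarrow> 'a \<Rightarrow> real) \<Rightarrow> bool" where
  "nondegenerate b \<longleftrightarrow>
     (\<forall>x. (\<forall>y. b x y = 0) \<longrightarrow> x = 0) \<and> (\<forall>y. (\<forall>x. b x y = 0) \<longrightarrow> y = 0)"

definition pseudo_metric :: "('a::real_vector \<Rightarrow> 'a \<Rightarrow> real) \<Rightarrow> bool" where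
  "pseudo_metric g \<longleftrightarrow> bilinear g \<and> (\<forall>x y. g x y = g y x) \<and> nondegenerate g"

definition nondegenerate_two_form :: "('a::real_vector \<Rightarrow> 'a \<Rightarrow> real) \<Rightarrow> bool" where
  "nondegenerate_two_form \<omega> \<longleftrightarrow>
     bilinear \<omega> \<and> (\<forall>x y. \<omega> x y = - \<omega> y x) \<and> nondegenerate \<omega>"

definition recursion_operator ::
  "('a::real_vector \<Rightarrow> 'a \<Rightarrow> real) \<Rightarrow> ('a \<Rightarrow> 'a \<Rightarrow> real) \<Rightarrow> ('a \<Rightarrow> 'a) \<Rightarrow> bool" where
  "recursion_operator a b A \<longleftrightarrow> linear A \<and> bij A \<and> (\<forall>x y. a (A x) y = b x y)"

lemma recursion_operator_unique:
  assumes "bilinear a" "nondegenerate a" "recursion_operator a b A" "recursion_operator a b A'"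
  shows "A = A'"
proof
  fix x
  have "a (A x - A' x) y = 0" for y
    using assms by (simp add: bilinear_lsub recursion_operator_def)
  then show "A x = A' x"
    using assms(2) unfolding nondegenerate_def by (metis right_minus_eq)
qed

definition ce_differential ::
  "('a::real_vector \<Rightarrow> 'a \<Rightarrow> 'a) \<Rightarrow> ('a \<Rightarrow> 'a \<Rightarrow> real) \<Rightarrow> 'a \<Rightarrow> 'a \<Rightarrow> 'a \<Rightarrow> real" where
  "ce_differential br \<omega> x y z = - \<omega> (br x y) z + \<omega> (br x z) y - \<omega> (br y z) x"

definition nijenhuis ::
  "('a::real_vector \<Rightarrow> 'a \<Rightarrow> 'a) \<Rightarrow> ('a \<Rightarrow> 'a) \<Rightarrow> 'a \<Rightarrow> 'a \<Rightarrow> 'a" where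
  "nijenhuis br J x y = br (J x) (J y) - J (br (J x) y) - J (br x (J y)) + J (J (br x y))"

text \<open>The operators \<open>A\<close>, \<open>B\<close>, \<open>J\<close> are determined by the triple
  (\<open>recursion_operator_unique\<close>); \<open>-J\<close>, not \<open>J\<close>, is the recursion operator from \<open>\<omega>\<close> to \<open>h\<close>.\<close>

definition born_structure_with ::
  "('a::real_vector \<Rightarrow> 'a \<Rightarrow> real) \<Rightarrow> ('a \<Rightarrow> 'a \<Rightarrow> real) \<Rightarrow> ('a \<Rightarrow> 'a \<Rightarrow> real) \<Rightarrow>
   ('a \<Rightarrow> 'a) \<Rightarrow> ('a \<Rightarrow> 'a) \<Rightarrow> ('a \<Rightarrow> 'a) \<Rightarrow> bool" where
  "born_structure_with g h \<omega> A B J \<longleftrightarrow>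
     pseudo_metric g \<and> pseudo_metric h \<and> nondegenerate_two_form \<omega> \<and>
     recursion_operator g \<omega> A \<and> recursion_operator g h B \<and>
     recursion_operator \<omega> h (\<lambda>x. - J x) \<and>
     (\<forall>x. A (A x) = x) \<and> (\<forall>x. B (B x) = x) \<and> (\<forall>x. J (J x) = - x)"

definition integrable_born_structure ::
  "('a::real_vector \<Rightarrow> 'a \<Rightarrow> 'a) \<Rightarrow>
   ('a \<Rightarrow> 'a \<Rightarrow> real) \<Rightarrow> ('a \<Rightarrow> 'a \<Rightarrow> real) \<Rightarrow> ('a \<Rightarrow> 'a \<Rightarrow> real) \<Rightarrow> bool" where
  "integrable_born_structure br g h \<omega> \<longleftrightarrow>
     (\<exists>A B J. born_structure_with g h \<omega> A B J \<and>
        (\<forall>x y z. ce_differential br \<omega> x y z = 0) \<and>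
        (\<forall>x y. nijenhuis br J x y = 0) \<and>
        lie_subalgebra br {x. A x = x} \<and> lie_subalgebra br {x. A x = - x})"

text \<open>The encoding \<open>(h, J, \<gg>\<^sub>\<plusminus>)\<close> of a Born structure, with \<open>V = \<gg>\<^sub>+\<close> and \<open>W = \<gg>\<^sub>-\<close>.\<close>

definition born_splitting ::
  "('a::real_vector \<Rightarrow> 'a \<Rightarrow> real) \<Rightarrow> ('a \<Rightarrow> 'a) \<Rightarrow> 'a set \<Rightarrow> 'a set \<Rightarrow> bool" where
  "born_splitting h J V W \<longleftrightarrow>
     pseudo_metric h \<and> linear J \<and> (\<forall>x. J (J x) = - x) \<and> (\<forall>x y. h (J x) (J y) = h x y) \<and>
     subspace V \<and> subspace W \<and> V \<inter> W = {0} \<and> (\<forall>x. \<exists>v\<in>V. \<exists>w\<in>W. x = v + w) \<and>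
     (\<forall>v\<in>V. \<forall>w\<in>W. h v w = 0) \<and> J ` V = W \<and> J ` W = V"

lemma born_structure_with_imp_splitting:
  assumes "born_structure_with g h \<omega> A B J"
  shows "born_splitting h J {x. A x = x} {x. A x = - x}"
    and "\<omega> = (\<lambda>x y. h (J x) y)" and "g = (\<lambda>x y. \<omega> (A x) y)"
proof -
  have g: "bilinear g" "\<And>x y. g x y = g y x" "nondegenerate g"
    and h: "pseudo_metric h" "bilinear h" "\<And>x y. h x y = h y x"
    and w: "bilinear \<omega>" "\<And>x y. \<omega> x y = - \<omega> y x"
    and A: "linear A" "\<And>x y. g (A x) y = \<omega> x y" "\<And>x. A (A x) = x"
    and B: "linear B" "\<And>x y. g (B x) y = h x y" "\<And>x. B (B x) = x"
    and mJ: "linear (\<lambda>x. - J x)" "\<And>x y. \<omega> (- J x) y = h x y"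
    and JJ: "\<And>x. J (J x) = - x"
    using assms unfolding born_structure_with_def pseudo_metric_def nondegenerate_two_form_def
      recursion_operator_def by blast+
  have J: "linear J"
    using linear_compose_neg[OF mJ(1)] by simp
  show w_h: "\<omega> = (\<lambda>x y. h (J x) y)"
  proof (intro ext)
    show "\<omega> x y = h (J x) y" for x y
      using mJ(2)[of "J x" y] by (simp add: JJ)
  qed
  show "g = (\<lambda>x y. \<omega> (A x) y)"
  proof (intro ext)
    show "g x y = \<omega> (A x) y" for x y
      using A(2)[of "A x" y] by (simp add: A(3))
  qed
  have hJ: "h (J x) (J y) = h x y" for x y
  proof -
    have "h (J x) (J y) = \<omega> x (J y)" by (simp add: w_h)
    also have "\<dots> = - \<omega> (J y) x" by (rule w(2))
    also have "\<dots> = h y x" using mJ(2)[of y x] by (simp add: bilinear_lneg[OF w(1)])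
    finally show ?thesis by (simp add: h(3))
  qed
  have BAJ: "B x = - A (J x)" for x
  proof -
    have "g (B x - - A (J x)) y = 0" for y
      using mJ(2)[of x y]
      by (simp add: bilinear_ladd[OF g(1)] A(2) B(2) bilinear_lneg[OF w(1)])
    then have "B x - - A (J x) = 0"
      using g(3) unfolding nondegenerate_def by blast
    then show ?thesis by (simp add: eq_neg_iff_add_eq_0)
  qed
  have AJ: "A (J x) = - J (A x)" for x
  proof -
    have "A (J (A (J x))) = x"
      using B(3)[of x] by (simp add: BAJ linear_neg[OF A(1)] linear_neg[OF J])
    then have "J (J (A (J x))) = J (A x)"
      using A(3)[of "J (A (J x))"] by simp
    then show ?thesis
      by (metis JJ add.inverse_inverse)
  qed
  have V: "subspace {x. A x = x}" and W: "subspace {x. A x = - x}"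
    by (auto simp: subspace_def linear_add[OF A(1)] linear_scale[OF A(1)] linear_0[OF A(1)])
  have inter: "{x. A x = x} \<inter> {x. A x = - x} = {0}"
  proof -
    have "x = 0" if "A x = x" "A x = - x" for x
    proof -
      have "2 *\<^sub>R x = x + A x" using that(1) by (simp add: scaleR_2)
      then show ?thesis using that(2) by simp
    qed
    then show ?thesis by (auto simp: linear_0[OF A(1)])
  qed
  have decomp: "\<exists>v\<in>{x. A x = x}. \<exists>w\<in>{x. A x = - x}. x = v + w" for x
  proof (intro bexI)
    show "x = (1/2) *\<^sub>R (x + A x) + (1/2) *\<^sub>R (x - A x)"
      by (simp add: scaleR_add_right scaleR_diff_right flip: scaleR_add_left)
  qed (auto simp: linear_add[OF A(1)] linear_diff[OF A(1)] linear_scale[OF A(1)] A(3) algebra_simps)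
  have iso: "\<omega> a b = 0" if "A a = - a" "A b = - b" for a b
    using A(2)[of a b] A(2)[of b a] w(2)[of a b] g(2)[of a b] that
    by (simp add: bilinear_lneg[OF g(1)])
  have orth: "h v w = 0" if "A v = v" "A w = - w" for v w
  proof -
    have "A (- J v) = - (- J v)"
      using that(1) by (simp add: linear_neg[OF A(1)] AJ)
    then show ?thesis
      using iso[of "- J v" w] that(2) by (simp add: mJ(2))
  qed
  have J_eigen: "A (J x) = - J x" if "A x = x" for x
    using that by (simp add: AJ)
  have J_eigen': "A (J x) = J x" if "A x = - x" for x
    using that by (simp add: AJ linear_neg[OF J])
  have swap: "J ` {x. A x = x} = {x. A x = - x}" "J ` {x. A x = - x} = {x. A x = x}"
  proof -
    have J': "x = J (- J x)" for x
      by (simp add: linear_neg[OF J] JJ)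
    show "J ` {x. A x = x} = {x. A x = - x}"
    proof
      show "{x. A x = - x} \<subseteq> J ` {x. A x = x}"
      proof
        fix x assume "x \<in> {x. A x = - x}"
        then have "A (- J x) = - J x" by (simp add: linear_neg[OF A(1)] J_eigen')
        then show "x \<in> J ` {x. A x = x}" using J'[of x] by blast
      qed
    qed (auto simp: J_eigen)
    show "J ` {x. A x = - x} = {x. A x = x}"
    proof
      show "{x. A x = x} \<subseteq> J ` {x. A x = - x}"
      proof
        fix x assume "x \<in> {x. A x = x}"
        then have "A (- J x) = - (- J x)" by (simp add: linear_neg[OF A(1)] J_eigen)
        then show "x \<in> J ` {x. A x = - x}" using J'[of x] by blast
      qed
    qed (auto simp: J_eigen')
  qed
  show "born_splitting h J {x. A x = x} {x. A x = - x}"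
    unfolding born_splitting_def
    using h(1) J JJ hJ V W inter decomp orth swap by auto
qed

lemma born_splitting_imp_structure_with:
  assumes "born_splitting h J V W"
  obtains g \<omega> A B where "born_structure_with g h \<omega> A B J"
    and "{x. A x = x} = V" and "{x. A x = - x} = W"
    and "\<omega> = (\<lambda>x y. h (J x) y)" and "g = (\<lambda>x y. \<omega> (A x) y)"
proof -
  have h: "pseudo_metric h"
    and J: "linear J" and JJs: "\<forall>x. J (J x) = - x" and hJs: "\<forall>x y. h (J x) (J y) = h x y"
    and V: "subspace V" and W: "subspace W" and int: "V \<inter> W = {0}"
    and dec: "\<forall>x. \<exists>v\<in>V. \<exists>w\<in>W. x = v + w"
    and orths: "\<forall>v\<in>V. \<forall>w\<in>W. h v w = 0"
    and JVW: "J ` V = W" "J ` W = V"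
    using assms[unfolded born_splitting_def] by - (elim conjE, assumption)+
  have hs: "bilinear h" "\<forall>x y. h x y = h y x" "nondegenerate h"
    using h[unfolded pseudo_metric_def] by - (elim conjE, assumption)+
  note h = h hs(1) hs(2)[rule_format] hs(3)
  note J = J JJs[rule_format] hJs[rule_format]
  note orth = orths[rule_format]
  have JV: "\<And>v. v \<in> V \<Longrightarrow> J v \<in> W" and JW: "\<And>w. w \<in> W \<Longrightarrow> J w \<in> V"
    using JVW by blast+
  obtain p where p: "\<And>x. p x \<in> V" "\<And>x. x - p x \<in> W"
    using dec by (metis add_diff_cancel_left')
  have p_eq: "p x = v" if "v \<in> V" "x - v \<in> W" for x v
  proof -
    have "p x - v \<in> V" using V p(1) that(1) by (simp add: subspace_diff)
    moreover have "p x - v \<in> W"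
      using subspace_diff[OF W that(2) p(2)[of x]] by simp
    ultimately have "p x - v \<in> {0}" by (simp flip: int)
    then show ?thesis by simp
  qed
  have "linear p"
  proof (rule linearI)
    fix x y
    show "p (x + y) = p x + p y"
    proof (rule p_eq)
      show "p x + p y \<in> V" by (simp add: V p(1) subspace_add)
      show "x + y - (p x + p y) \<in> W"
        using subspace_add[OF W p(2)[of x] p(2)[of y]] by (simp add: algebra_simps)
    qed
  next
    fix c x
    show "p (c *\<^sub>R x) = c *\<^sub>R p x"
    proof (rule p_eq)
      show "c *\<^sub>R p x \<in> V" by (simp add: V p(1) subspace_scale)
      show "c *\<^sub>R x - c *\<^sub>R p x \<in> W"
        using subspace_scale[OF W p(2)[of x], of c] by (simp add: algebra_simps)
    qed
  qed
  define A where "A x = p x - (x - p x)" for x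
  define \<omega> where "\<omega> = (\<lambda>x y. h (J x) y)"
  define g where "g = (\<lambda>x y. \<omega> (A x) y)"
  define B where "B x = - A (J x)" for x
  have A: "linear A"
    unfolding A_def using \<open>linear p\<close> by (auto intro!: linear_compose_sub linear_ident)
  have AV: "A v = v" if "v \<in> V" for v
    using p_eq[of v v] that W by (simp add: A_def subspace_0)
  have AW: "A w = - w" if "w \<in> W" for w
    using p_eq[of 0 w] that V by (simp add: A_def subspace_0)
  have Asplit: "A x = p x - (x - p x)" "x = p x + (x - p x)" for x
    by (simp_all add: A_def)
  have AA: "A (A x) = x" for x
    using linear_diff[OF A, of "p x" "x - p x"] AV[OF p(1)[of x]] AW[OF p(2)[of x]]
    by (simp add: Asplit(1)[of x])
  have AJ: "A (J x) = - J (A x)" for x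
  proof -
    have "A (J x) = A (J (p x)) + A (J (x - p x))"
      by (metis Asplit(2) linear_add[OF A] linear_add[OF J(1)])
    also have "\<dots> = - J (p x) + J (x - p x)"
      using p by (simp add: AV AW JV JW)
    also have "\<dots> = - J (A x)"
      by (simp add: A_def linear_diff[OF J(1)])
    finally show ?thesis .
  qed
  have hA: "h (A x) y = h x (A y)" for x y
  proof -
    have "h (A x) y = h (p x - (x - p x)) (p y + (y - p y))" by (simp add: A_def)
    also have "\<dots> = h (p x + (x - p x)) (p y - (y - p y))"
      unfolding bilinear_ladd[OF h(2)] bilinear_radd[OF h(2)] bilinear_lsub[OF h(2)]
        bilinear_rsub[OF h(2)]
      using orth[OF p(1)[of x] p(2)[of y]] orth[OF p(1)[of y] p(2)[of x]]
      by (simp add: h(3) bilinear_rsub[OF h(2)] bilinear_lsub[OF h(2)])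
    also have "\<dots> = h x (A y)" by (simp add: A_def)
    finally show ?thesis .
  qed
  have hJ: "h (J x) y = - h x (J y)" for x y
    using J(3)[of x "J y"] by (simp add: J(2) bilinear_rneg[OF h(2)])
  have lin_h: "linear (\<lambda>y. h x y)" "linear (\<lambda>x. h x y)" for x y
    using h(2) by (auto simp: bilinear_def)
  have bw: "bilinear \<omega>"
    unfolding \<omega>_def bilinear_def
    using lin_h linear_compose[OF J(1) lin_h(2)] by (auto simp: o_def)
  have lin_w: "linear (\<lambda>y. \<omega> x y)" "linear (\<lambda>x. \<omega> x y)" for x y
    using bw by (auto simp: bilinear_def)
  have bg: "bilinear g"
    unfolding g_def bilinear_def
    using lin_w linear_compose[OF A lin_w(2)] by (auto simp: o_def)
  have ws: "\<omega> x y = - \<omega> y x" for x y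
    unfolding \<omega>_def using hJ h(3) by metis
  have gs: "g x y = g y x" for x y
  proof -
    have "g x y = - h (A x) (J y)" by (simp add: g_def \<omega>_def hJ)
    also have "\<dots> = - h (A (J y)) x" by (simp add: hA h(3))
    also have "\<dots> = h (J (A y)) x" by (simp add: AJ bilinear_lneg[OF h(2)])
    finally show ?thesis by (simp add: g_def \<omega>_def)
  qed
  have J0: "x = 0" if "J x = 0" for x
    using J(2)[of x] that linear_0[OF J(1)] by simp
  have A0: "x = 0" if "A x = 0" for x
    using AA[of x] that linear_0[OF A] by simp
  have wl: "x = 0" if "\<forall>y. \<omega> x y = 0" for x
    using that h(4) J0 unfolding \<omega>_def nondegenerate_def by blast
  have w_nd: "nondegenerate \<omega>"
    unfolding nondegenerate_def using wl ws by (metis neg_equal_0_iff_equal)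
  have gl: "x = 0" if "\<forall>y. g x y = 0" for x
    using that wl A0 unfolding g_def by blast
  have g_nd: "nondegenerate g"
    unfolding nondegenerate_def using gl gs by metis
  have B: "linear B"
    unfolding B_def using linear_compose_neg[OF linear_compose[OF J(1) A]] by (simp add: o_def)
  have BB: "B (B x) = x" for x
    by (simp add: B_def AJ AA J(2) linear_neg[OF A] linear_neg[OF J(1)])
  have mJ: "linear (\<lambda>x. - J x)" using J(1) by (rule linear_compose_neg)
  have "born_structure_with g h \<omega> A B J"
    unfolding born_structure_with_def pseudo_metric_def nondegenerate_two_form_def
      recursion_operator_def
  proof (intro conjI allI)
    show "bij A" using AA by (intro o_bij[of A]) (auto simp: fun_eq_iff)
    show "bij B" using BB by (intro o_bij[of B]) (auto simp: fun_eq_iff)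
    show "bij (\<lambda>x. - J x)"
      by (intro o_bij[of J]) (auto simp: fun_eq_iff J(2) linear_neg[OF J(1)])
    show "g (A x) y = \<omega> x y" for x y by (simp add: g_def AA)
    show "g (B x) y = h x y" for x y
      by (simp add: g_def \<omega>_def B_def AA J(2) linear_neg[OF A] linear_neg[OF J(1)])
    show "\<omega> (- J x) y = h x y" for x y
      by (simp add: \<omega>_def J(2) linear_neg[OF J(1)])
  qed (fact bg gs g_nd h bw ws w_nd A B mJ AA BB J(2))+
  moreover have "{x. A x = x} = V"
  proof -
    have "x \<in> V" if "A x = x" for x
    proof -
      have "2 *\<^sub>R (x - p x) = 0" using that by (simp add: A_def scaleR_2 algebra_simps)
      then show ?thesis using p(1)[of x] by simp
    qed
    then show ?thesis using AV by auto
  qed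
  moreover have "{x. A x = - x} = W"
  proof -
    have "x \<in> W" if "A x = - x" for x
    proof -
      have "2 *\<^sub>R p x = 0" using that by (simp add: A_def scaleR_2 algebra_simps)
      then show ?thesis using p(2)[of x] by simp
    qed
    then show ?thesis using AW by auto
  qed
  ultimately show ?thesis using that \<omega>_def g_def by blast
qed

lemma integrable_born_structure_iff_splitting:
  "(\<exists>g \<omega>. integrable_born_structure br g h \<omega>) \<longleftrightarrow>
   (\<exists>J V W. born_splitting h J V W \<and>
      (\<forall>x y z. ce_differential br (\<lambda>x y. h (J x) y) x y z = 0) \<and>
      (\<forall>x y. nijenhuis br J x y = 0) \<and> lie_subalgebra br V \<and> lie_subalgebra br W)"
    (is "?L \<longleftrightarrow> ?R")
proof
  assume ?L
  then obtain g \<omega> A B J where *: "born_structure_with g h \<omega> A B J"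
    and **: "\<forall>x y z. ce_differential br \<omega> x y z = 0" "\<forall>x y. nijenhuis br J x y = 0"
      "lie_subalgebra br {x. A x = x}" "lie_subalgebra br {x. A x = - x}"
    unfolding integrable_born_structure_def by (elim exE conjE)
  show ?R
    using born_structure_with_imp_splitting(1)[OF *]
      **(1)[unfolded born_structure_with_imp_splitting(2)[OF *]] **(2-4)
    by (intro exI conjI)
next
  assume ?R
  then obtain J V W where *: "born_splitting h J V W"
    and **: "\<forall>x y z. ce_differential br (\<lambda>x y. h (J x) y) x y z = 0"
      "\<forall>x y. nijenhuis br J x y = 0" "lie_subalgebra br V" "lie_subalgebra br W"
    by (elim exE conjE)
  from * obtain g \<omega> A B where "born_structure_with g h \<omega> A B J"
    "{x. A x = x} = V" "{x. A x = - x} = W" "\<omega> = (\<lambda>x y. h (J x) y)"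
    by (rule born_splitting_imp_structure_with)
  with ** have "integrable_born_structure br g h \<omega>"
    unfolding integrable_born_structure_def by (intro exI[of _ A] exI[of _ B] exI[of _ J]) simp
  then show ?L by blast
qed

section \<open>The Lie algebras of the classification\<close>

text \<open>Each bracket on \<open>\<real>\<^sup>4\<close> is the sum over the listed \<open>[e\<^sub>i, e\<^sub>j]\<close> of
  \<open>(x\<^sub>i y\<^sub>j - x\<^sub>j y\<^sub>i) [e\<^sub>i, e\<^sub>j]\<close>.\<close>

definition wedge :: "4 \<Rightarrow> 4 \<Rightarrow> real^4 \<Rightarrow> real^4 \<Rightarrow> real" where
  "wedge i j x y = x $ i * y $ j - x $ j * y $ i"

definition basis_vec :: "4 \<Rightarrow> real^4" where
  "basis_vec i = axis i 1"

definition rh3 :: "real^4 \<Rightarrow> real^4 \<Rightarrow> real^4" where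
  "rh3 x y = wedge 1 2 x y *\<^sub>R basis_vec 3"

definition rr30 :: "real^4 \<Rightarrow> real^4 \<Rightarrow> real^4" where
  "rr30 x y = wedge 1 2 x y *\<^sub>R basis_vec 2"

definition r2r2 :: "real^4 \<Rightarrow> real^4 \<Rightarrow> real^4" where
  "r2r2 x y = wedge 1 2 x y *\<^sub>R basis_vec 2 + wedge 3 4 x y *\<^sub>R basis_vec 4"

definition r2' :: "real^4 \<Rightarrow> real^4 \<Rightarrow> real^4" where
  "r2' x y = wedge 1 3 x y *\<^sub>R basis_vec 3 + wedge 1 4 x y *\<^sub>R basis_vec 4 +
     wedge 2 3 x y *\<^sub>R basis_vec 4 + wedge 2 4 x y *\<^sub>R (- basis_vec 3)"

text \<open>\<open>\<rr>\<^bsub>4,-1,-1\<^esub>\<close>\<close>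

definition r4m1m1 :: "real^4 \<Rightarrow> real^4 \<Rightarrow> real^4" where
  "r4m1m1 x y = wedge 1 4 x y *\<^sub>R (- basis_vec 1) + wedge 2 4 x y *\<^sub>R basis_vec 2 +
     wedge 3 4 x y *\<^sub>R basis_vec 3"

definition d41 :: "real^4 \<Rightarrow> real^4 \<Rightarrow> real^4" where
  "d41 x y = wedge 1 2 x y *\<^sub>R basis_vec 3 + wedge 1 4 x y *\<^sub>R (- basis_vec 1) +
     wedge 3 4 x y *\<^sub>R (- basis_vec 3)"

definition d42 :: "real^4 \<Rightarrow> real^4 \<Rightarrow> real^4" where
  "d42 x y = wedge 1 2 x y *\<^sub>R basis_vec 3 + wedge 1 4 x y *\<^sub>R (- 2 *\<^sub>R basis_vec 1) +
     wedge 2 4 x y *\<^sub>R basis_vec 2 + wedge 3 4 x y *\<^sub>R (- basis_vec 3)"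

text \<open>\<open>\<dd>\<^bsub>4,1/2\<^esub>\<close>\<close>

definition d4half :: "real^4 \<Rightarrow> real^4 \<Rightarrow> real^4" where
  "d4half x y = wedge 1 2 x y *\<^sub>R basis_vec 3 + wedge 1 4 x y *\<^sub>R (- (1/2) *\<^sub>R basis_vec 1) +
     wedge 2 4 x y *\<^sub>R (- (1/2) *\<^sub>R basis_vec 2) + wedge 3 4 x y *\<^sub>R (- basis_vec 3)"

lemmas listed_lie_defs =
  rh3_def rr30_def r2r2_def r2'_def r4m1m1_def d41_def d42_def d4half_def

lemma lie_algebra_listed:
  "lie_algebra rh3" "lie_algebra rr30" "lie_algebra r2r2" "lie_algebra r2'"
  "lie_algebra r4m1m1" "lie_algebra d41" "lie_algebra d42" "lie_algebra d4half"
  by (auto simp: lie_algebra_def bilinear_def linear_iff listed_lie_defs wedge_def basis_vec_def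
      axis_def vec_eq_iff forall_4 algebra_simps add_divide_distrib)

end

theory Submission
  imports Defs
begin

text \<open>
  Let \<open>V\<close> and \<open>W = J V\<close> be the eigenspaces of \<open>A\<close>.  They are two-dimensional, \<open>h\<close>-orthogonal
  and Lagrangian for \<open>\<omega> = h(J\<cdot>,\<cdot>)\<close>, and integrability says that \<open>(h,J)\<close> is pseudo-Kaehler, so the
  Levi-Civita connection of \<open>h\<close> commutes with \<open>J\<close>.  For \<open>v\<close>, \<open>v'\<close> in \<open>V\<close> its value is therefore
  \<open>D\<^sub>v v' = \<alpha>(v) \<epsilon> v' + J S(v) v'\<close> and \<open>D\<^bsub>Jv\<^esub> v' = \<beta>(v) \<epsilon> v' + J T(v) v'\<close>, where \<open>\<epsilon>\<close> generates the
  one-dimensional Lie algebra \<open>so(V,h)\<close>, \<open>\<alpha>\<close> and \<open>\<beta>\<close> are linear forms on \<open>V\<close>, and \<open>S\<close> and \<open>T\<close>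
  are totally symmetric cubic forms, read as operators through \<open>h\<close>: the second fundamental forms
  of the two leaves.  Since \<open>D\<close> is torsion-free, the bracket is a linear function of these twelve
  numbers.  The resulting normal forms are derived below directly from \<open>d\<omega> = 0\<close> and
  \<open>N\<^sub>J = 0\<close>, without the connection: \<open>orthogonal_frame_brackets\<close> and
  \<open>isotropic_frame_brackets\<close>.  What remains is the Jacobi identity, a system of quadratic equations.

  If both leaves are abelian, the Jacobi identity says that all operators \<open>S(v)\<close>, \<open>T(v)\<close> lie in one
  two-dimensional commutative algebra \<open>K = \<real>[M]\<close> with \<open>M\<^sup>2 = c\<close>.  Then \<open>V\<close> is a free \<open>K\<close>-module of
  rank one and the whole Lie algebra is \<open>K\<^sup>2\<close> with the bracket \<open>[X,Y] = - det(X,Y) z\<close> for a fixed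
  \<open>z\<close> in \<open>K\<^sup>2\<close>.  For unimodular \<open>z\<close> it is the affine Lie algebra of \<open>K\<close>, which is \<open>\<rr>\<^sub>2\<rr>\<^sub>2\<close>,
  \<open>\<rr>'\<^sub>2\<close> or \<open>\<dd>\<^bsub>4,1\<^esub>\<close> according to the sign of \<open>c\<close>; otherwise the derived ideal is at most a line,
  which leaves \<open>\<rr>\<hh>\<^sub>3\<close> and \<open>\<rr>\<rr>\<^bsub>3,0\<^esub>\<close> (\<open>planar_algebra_cases\<close>).

  If one leaf, say \<open>V\<close>, is not abelian, a generator \<open>v\<^sub>2\<close> of its derived ideal is a
  distinguished frame vector.  When \<open>h(v\<^sub>2,v\<^sub>2) \<noteq> 0\<close>, complete it to an orthogonal basis; the
  Jacobi equations then have two families of solutions, one consisting of copies of \<open>\<dd>\<^bsub>4,1/2\<^esub>\<close>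
  and one of copies of \<open>\<dd>\<^bsub>4,2\<^esub>\<close>.  When \<open>v\<^sub>2\<close> is isotropic, complete it to an isotropic
  basis; every solution is then a copy of \<open>\<rr>\<^bsub>4,-1,-1\<^esub>\<close>.

  Conversely, the same normal forms suggest an explicit \<open>h\<close> and \<open>J\<close> on each listed algebra with
  \<open>V\<close> and \<open>W\<close> coordinate planes, and integrable Born structures can be transported along isomorphisms.
\<close>

section \<open>Frames\<close>

lemma vector_4 [simp]:
  "(vector [a, b, c, d] :: 'a::zero^4)$1 = a" "(vector [a, b, c, d] :: 'a^4)$2 = b"
  "(vector [a, b, c, d] :: 'a^4)$3 = c" "(vector [a, b, c, d] :: 'a^4)$4 = d"
  by (simp_all add: vector_def)

text \<open>A predicate on quadruples, since independence of the set \<open>{e\<^sub>1, e\<^sub>2, e\<^sub>3, e\<^sub>4}\<close> would allow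
  repeated vectors.\<close>

definition frame :: "'a::real_vector \<Rightarrow> 'a \<Rightarrow> 'a \<Rightarrow> 'a \<Rightarrow> bool" where
  "frame e\<^sub>1 e\<^sub>2 e\<^sub>3 e\<^sub>4 \<longleftrightarrow>
     (\<forall>a b c d. a *\<^sub>R e\<^sub>1 + b *\<^sub>R e\<^sub>2 + c *\<^sub>R e\<^sub>3 + d *\<^sub>R e\<^sub>4 = 0 \<longrightarrow> a = 0 \<and> b = 0 \<and> c = 0 \<and> d = 0)"

lemma frameI:
  assumes "\<And>a b c d. a *\<^sub>R e\<^sub>1 + b *\<^sub>R e\<^sub>2 + c *\<^sub>R e\<^sub>3 + d *\<^sub>R e\<^sub>4 = 0 \<Longrightarrow> a = 0 \<and> b = 0 \<and> c = 0 \<and> d = 0"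
  shows "frame e\<^sub>1 e\<^sub>2 e\<^sub>3 e\<^sub>4"
  using assms unfolding frame_def by blast

lemma frameD:
  assumes "frame e\<^sub>1 e\<^sub>2 e\<^sub>3 e\<^sub>4" "a *\<^sub>R e\<^sub>1 + b *\<^sub>R e\<^sub>2 + c *\<^sub>R e\<^sub>3 + d *\<^sub>R e\<^sub>4 = 0"
  shows "a = 0" "b = 0" "c = 0" "d = 0"
  using assms unfolding frame_def by blast+

definition comb :: "'a::real_vector \<Rightarrow> 'a \<Rightarrow> 'a \<Rightarrow> 'a \<Rightarrow> real^4 \<Rightarrow> 'a" where
  "comb e\<^sub>1 e\<^sub>2 e\<^sub>3 e\<^sub>4 x = x$1 *\<^sub>R e\<^sub>1 + x$2 *\<^sub>R e\<^sub>2 + x$3 *\<^sub>R e\<^sub>3 + x$4 *\<^sub>R e\<^sub>4"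

lemma linear_comb: "linear (comb e\<^sub>1 e\<^sub>2 e\<^sub>3 e\<^sub>4)"
  by (rule linearI) (simp_all add: comb_def algebra_simps)

lemma bij_comb:
  fixes e\<^sub>1 e\<^sub>2 e\<^sub>3 e\<^sub>4 :: "'a::euclidean_space"
  assumes "frame e\<^sub>1 e\<^sub>2 e\<^sub>3 e\<^sub>4" "DIM('a) = 4"
  shows "bij (comb e\<^sub>1 e\<^sub>2 e\<^sub>3 e\<^sub>4)"
proof -
  have "x = 0" if "comb e\<^sub>1 e\<^sub>2 e\<^sub>3 e\<^sub>4 x = 0" for x
    using frameD[OF assms(1) that[unfolded comb_def]] by (simp add: vec_eq_iff forall_4)
  then have inj: "inj (comb e\<^sub>1 e\<^sub>2 e\<^sub>3 e\<^sub>4)"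
    by (simp add: linear_injective_0[OF linear_comb])
  then have "dim (range (comb e\<^sub>1 e\<^sub>2 e\<^sub>3 e\<^sub>4)) = DIM('a)"
    using dim_image_eq[OF linear_comb, of _ _ _ _ UNIV] assms(2) by simp
  then have "range (comb e\<^sub>1 e\<^sub>2 e\<^sub>3 e\<^sub>4) = UNIV"
    using linear_subspace_image[OF linear_comb subspace_UNIV] dim_eq_full span_eq_iff by metis
  with inj show ?thesis by (simp add: bij_def)
qed

lemma frame_span:
  fixes e\<^sub>1 e\<^sub>2 e\<^sub>3 e\<^sub>4 :: "'a::euclidean_space"
  assumes "frame e\<^sub>1 e\<^sub>2 e\<^sub>3 e\<^sub>4" "DIM('a) = 4"
  obtains a b c d where "x = a *\<^sub>R e\<^sub>1 + b *\<^sub>R e\<^sub>2 + c *\<^sub>R e\<^sub>3 + d *\<^sub>R e\<^sub>4"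
  using bij_comb[OF assms] unfolding bij_def surj_def comb_def by metis

lemma linear_inv:
  assumes "linear f" "bij f"
  shows "linear (inv f)"
proof -
  have inv: "f (inv f y) = y" for y using assms(2) by (simp add: bij_def surj_f_inv_f)
  have inj: "x = y" if "f x = f y" for x y using assms(2) that by (simp add: bij_def inj_eq)
  show ?thesis
    by (rule linearI; rule inj) (simp_all add: inv linear_add[OF assms(1)] linear_scale[OF assms(1)])
qed

lemma scaleR_twice:
  "x *\<^sub>R v + x *\<^sub>R v = (x * 2) *\<^sub>R (v :: 'a::real_vector)"
  "x *\<^sub>R v + (x *\<^sub>R v + w) = (x * 2) *\<^sub>R v + w"
  by (simp_all only: mult_2_right scaleR_add_left add.assoc)

lemma frame_shear:
  assumes "frame a b c d"
  shows "frame a b (c + p *\<^sub>R a + q *\<^sub>R b) (d + r *\<^sub>R a + s *\<^sub>R b)"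
proof (rule frameI)
  fix k l m n
  assume *: "k *\<^sub>R a + l *\<^sub>R b + m *\<^sub>R (c + p *\<^sub>R a + q *\<^sub>R b) + n *\<^sub>R (d + r *\<^sub>R a + s *\<^sub>R b) = 0"
  have "(k + m * p + n * r) *\<^sub>R a + (l + m * q + n * s) *\<^sub>R b + m *\<^sub>R c + n *\<^sub>R d = 0"
    using * by (simp add: algebra_simps)
  from frameD[OF assms this] show "k = 0 \<and> l = 0 \<and> m = 0 \<and> n = 0" by simp
qed

lemma coefficient_zero_outside_span:
  assumes "u \<notin> span S" "s \<in> span S" "s + a *\<^sub>R u = 0"
  shows "a = 0"
proof (rule ccontr)
  assume a: "a \<noteq> 0"
  have "a *\<^sub>R u = - s" using assms(3) by (simp only: add_eq_0_iff)
  then have "a *\<^sub>R u \<in> span S" using span_neg[OF assms(2)] by simp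
  then have "(1 / a) *\<^sub>R a *\<^sub>R u \<in> span S" by (rule span_scale)
  with a assms(1) show False by simp
qed

lemma extend_triple_to_frame:
  fixes x y z :: "'a::euclidean_space"
  assumes dim: "DIM('a) = 4"
    and ind: "\<And>a b c. a *\<^sub>R x + b *\<^sub>R y + c *\<^sub>R z = 0 \<Longrightarrow> a = 0 \<and> b = 0 \<and> c = 0"
  obtains u where "frame x y z u"
proof -
  have "dim {x, y, z} \<le> card {x, y, z}" by (rule dim_le_card') simp
  also have "\<dots> \<le> 3" by (simp add: card_insert_if)
  finally have "dim {x, y, z} < 4" by simp
  then have "span {x, y, z} \<noteq> UNIV"
    using dim by (metis dim_UNIV dim_span less_irrefl)
  then obtain u where u: "u \<notin> span {x, y, z}" by blast
  have "frame x y z u"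
  proof (rule frameI)
    fix a b c d
    assume *: "a *\<^sub>R x + b *\<^sub>R y + c *\<^sub>R z + d *\<^sub>R u = 0"
    have "a *\<^sub>R x + b *\<^sub>R y + c *\<^sub>R z \<in> span {x, y, z}"
      by (intro span_scale span_add) (auto intro: span_base)
    then have "d = 0" using coefficient_zero_outside_span[OF u _ *] by blast
    with * ind[of a b c] show "a = 0 \<and> b = 0 \<and> c = 0 \<and> d = 0" by simp
  qed
  then show ?thesis by (rule that)
qed

lemma extend_pair_to_frame:
  fixes x y :: "'a::euclidean_space"
  assumes dim: "DIM('a) = 4"
    and ind: "\<And>a b. a *\<^sub>R x + b *\<^sub>R y = 0 \<Longrightarrow> a = 0 \<and> b = 0"
  obtains u v where "frame x y u v"
proof -
  have "dim {x, y} \<le> card {x, y}" by (rule dim_le_card') simp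
  also have "\<dots> \<le> 2" by (simp add: card_insert_if)
  finally have "dim {x, y} < 4" by simp
  then have "span {x, y} \<noteq> UNIV"
    using dim by (metis dim_UNIV dim_span less_irrefl)
  then obtain u where u: "u \<notin> span {x, y}" by blast
  have ind3: "a = 0 \<and> b = 0 \<and> c = 0" if *: "a *\<^sub>R x + b *\<^sub>R y + c *\<^sub>R u = 0" for a b c
  proof -
    have "a *\<^sub>R x + b *\<^sub>R y \<in> span {x, y}"
      by (intro span_scale span_add) (auto intro: span_base)
    then have "c = 0" using coefficient_zero_outside_span[OF u _ *] by blast
    with * ind[of a b] show ?thesis by simp
  qed
  show ?thesis
    by (rule extend_triple_to_frame[OF dim ind3]) (auto intro: that)
qed

lemma ex_linear_bij_real4:
  assumes "dim (UNIV :: 'a::real_vector set) = 4"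
  obtains f :: "'a::real_vector \<Rightarrow> real^4" where "linear f" "bij f"
proof -
  obtain S :: "'a set" where S: "independent S" "UNIV \<subseteq> span S" "card S = 4"
    using basis_exists[of "UNIV :: 'a set"] assms by metis
  have "card S = Suc (Suc (Suc (Suc 0)))" using S(3) by simp
  then obtain a b c d where eq: "S = {a, b, c, d}" and dist: "distinct [a, b, c, d]"
    unfolding card_Suc_eq by auto
  have ne: "a \<noteq> b" "a \<noteq> c" "a \<noteq> d" "b \<noteq> c" "b \<noteq> d" "c \<noteq> d" using dist by simp_all
  note ne = ne ne[symmetric]
  define \<phi> where "\<phi> = comb a b c d"
  have lin: "linear \<phi>" unfolding \<phi>_def by (rule linear_comb)
  define coef where "coef x v = (if v = a then x$1 else if v = b then x$2 else if v = c then x$3 else x$4)"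
    for x :: "real^4" and v
  have sum: "(\<Sum>v\<in>S. coef x v *\<^sub>R v) = \<phi> x" for x
    by (simp add: ne eq coef_def \<phi>_def comb_def add.assoc)
  have "x = 0" if "\<phi> x = 0" for x
  proof -
    have "\<forall>v\<in>S. coef x v = 0"
      using S(1) that sum dependent_finite[of S] by (auto simp: eq)
    then show ?thesis by (simp add: ne eq coef_def vec_eq_iff forall_4)
  qed
  then have "inj \<phi>" by (simp add: linear_injective_0[OF lin])
  moreover have "surj \<phi>"
  proof -
    have "\<exists>x. y = \<phi> x" for y
    proof -
      have "y \<in> span S" using S(2) by blast
      then obtain u where "y = (\<Sum>v\<in>S. u v *\<^sub>R v)"
        using span_finite[of S] by (auto simp: eq)
      then have "y = \<phi> (vector [u a, u b, u c, u d])"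
        by (simp add: ne eq \<phi>_def comb_def add.assoc)
      then show ?thesis ..
    qed
    then show ?thesis unfolding surj_def by blast
  qed
  ultimately have bij: "bij \<phi>" by (simp add: bij_def)
  have inv: "\<phi> (inv \<phi> y) = y" "inv \<phi> (\<phi> x) = x" for x y
    using bij by (simp_all add: bij_def surj_f_inv_f)
  show ?thesis
    using linear_inv[OF lin bij] bij_imp_bij_inv[OF bij] that by blast
qed

section \<open>Transport along isomorphisms\<close>

lemma lie_algebraD:
  assumes "lie_algebra br"
  shows "bilinear br" "br x x = 0" "br x y = - br y x"
    "br x (br y z) + br y (br z x) + br z (br x y) = 0"
proof -
  show bl: "bilinear br" and xx: "\<And>x. br x x = 0"
    and "br x (br y z) + br y (br z x) + br z (br x y) = 0"
    using assms unfolding lie_algebra_def by blast+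
  have "0 = br (x + y) (x + y)" by (simp only: xx)
  also have "\<dots> = br x y + br y x"
    unfolding bilinear_ladd[OF bl] bilinear_radd[OF bl] by (simp add: xx)
  finally show "br x y = - br y x"
    by (simp add: eq_neg_iff_add_eq_0)
qed

lemmas bilinear_expand =
  bilinear_ladd bilinear_radd bilinear_lmul bilinear_rmul bilinear_lneg bilinear_rneg
  bilinear_lsub bilinear_rsub bilinear_lzero bilinear_rzero

lemma lie_isomorphic_sym:
  assumes "lie_isomorphic br br'"
  shows "lie_isomorphic br' br"
proof -
  obtain f where f: "linear f" "bij f" "\<And>x y. f (br x y) = br' (f x) (f y)"
    using assms unfolding lie_isomorphic_def by blast
  have inv: "f (inv f y) = y" "inv f (f x) = x" for x y
    using f(2) by (simp_all add: bij_def surj_f_inv_f)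
  have "linear (inv f)" by (rule linear_inv[OF f(1,2)])
  moreover have "inv f (br' x y) = br (inv f x) (inv f y)" for x y
    by (metis f(3) inv)
  ultimately show ?thesis
    using bij_imp_bij_inv[OF f(2)] unfolding lie_isomorphic_def by blast
qed

lemma lie_isomorphic_trans:
  assumes "lie_isomorphic br br'" "lie_isomorphic br' br''"
  shows "lie_isomorphic br br''"
proof -
  obtain f where f: "linear f" "bij f" "\<And>x y. f (br x y) = br' (f x) (f y)"
    using assms(1) unfolding lie_isomorphic_def by blast
  obtain g where g: "linear g" "bij g" "\<And>x y. g (br' x y) = br'' (g x) (g y)"
    using assms(2) unfolding lie_isomorphic_def by blast
  have "linear (g \<circ> f)" by (rule linear_compose[OF f(1) g(1)])
  moreover have "bij (g \<circ> f)" by (rule bij_comp[OF f(2) g(2)])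
  moreover have "(g \<circ> f) (br x y) = br'' ((g \<circ> f) x) ((g \<circ> f) y)" for x y
    by (simp add: f(3) g(3))
  ultimately show ?thesis unfolding lie_isomorphic_def by blast
qed

lemma bilinear_pullback:
  assumes "bilinear b" "linear f"
  shows "bilinear (\<lambda>x y. b (f x) (f y))"
  unfolding bilinear_def
  by (simp add: linear_iff linear_add[OF assms(2)] linear_scale[OF assms(2)] bilinear_expand[OF assms(1)])

lemma nondegenerate_pullback:
  assumes "nondegenerate b" "linear f" "bij f"
  shows "nondegenerate (\<lambda>x y. b (f x) (f y))"
proof -
  have inj: "f x = 0 \<Longrightarrow> x = 0" for x
    using assms(2,3) by (simp add: bij_def linear_injective_0)
  have surj: "\<exists>x. y = f x" for y
    using assms(3) by (simp add: bij_def surj_def)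
  show ?thesis
    using assms(1) inj surj unfolding nondegenerate_def by metis
qed

lemma integrable_born_structure_isomorphic:
  assumes iso: "lie_isomorphic br br'" and "integrable_born_structure br' g h \<omega>"
  shows "\<exists>g h \<omega>. integrable_born_structure br g h \<omega>"
proof -
  obtain f where f: "linear f" "bij f" "\<And>x y. f (br x y) = br' (f x) (f y)"
    using iso unfolding lie_isomorphic_def by blast
  have inv: "f (inv f y) = y" "inv f (f x) = x" for x y
    using f(2) by (simp_all add: bij_def surj_f_inv_f)
  have lin_inv: "linear (inv f)" by (rule linear_inv[OF f(1,2)])
  obtain A B J where born: "born_structure_with g h \<omega> A B J"
    and int: "\<And>x y z. ce_differential br' \<omega> x y z = 0" "\<And>x y. nijenhuis br' J x y = 0"
      "lie_subalgebra br' {x. A x = x}" "lie_subalgebra br' {x. A x = - x}"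
    using assms(2) unfolding integrable_born_structure_def by (elim exE conjE) blast
  define pull where "pull b x y = b (f x) (f y)" for b :: "'b \<Rightarrow> 'b \<Rightarrow> real" and x y
  define conjugate where "conjugate T x = inv f (T (f x))" for T x
  have f_conj: "f (conjugate T x) = T (f x)" for T x by (simp add: conjugate_def inv)
  have inj: "f x = f y \<longleftrightarrow> x = y" for x y using f(2) by (simp add: bij_def inj_eq)
  have f_neg: "f (- x) = - f x" for x by (rule linear_neg[OF f(1)])
  have metric: "pseudo_metric (pull b)" if "pseudo_metric b" for b
    using that bilinear_pullback[OF _ f(1), of b] nondegenerate_pullback[OF _ f(1,2), of b]
    unfolding pseudo_metric_def by (simp add: pull_def[abs_def])
  have two_form: "nondegenerate_two_form (pull \<omega>)" if "nondegenerate_two_form \<omega>"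
    unfolding nondegenerate_two_form_def pull_def[abs_def]
    using that[unfolded nondegenerate_two_form_def] bilinear_pullback[OF _ f(1), of \<omega>]
      nondegenerate_pullback[OF _ f(1,2), of \<omega>] by blast
  have rec: "recursion_operator (pull a) (pull b) (conjugate T)" if "recursion_operator a b T" for a b T
  proof -
    have T: "linear T" "bij T" "\<And>x y. a (T x) y = b x y"
      using that by (auto simp: recursion_operator_def)
    have eq: "conjugate T = inv f \<circ> (T \<circ> f)" by (simp add: fun_eq_iff conjugate_def)
    have "linear (conjugate T)" unfolding eq by (rule linear_compose[OF linear_compose[OF f(1) T(1)] lin_inv])
    moreover have "bij (conjugate T)" unfolding eq by (rule bij_comp[OF bij_comp[OF f(2) T(2)] bij_imp_bij_inv[OF f(2)]])
    ultimately show ?thesis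
      unfolding recursion_operator_def by (simp add: pull_def f_conj T(3))
  qed
  have neg: "(\<lambda>x. - conjugate J x) = conjugate (\<lambda>x. - J x)"
    by (simp add: fun_eq_iff conjugate_def linear_neg[OF lin_inv])
  have "born_structure_with (pull g) (pull h) (pull \<omega>) (conjugate A) (conjugate B) (conjugate J)"
  proof -
    have "conjugate T (conjugate T x) = x" if "\<And>x. T (T x) = x" for T x
      by (simp add: conjugate_def inv that)
    moreover have "conjugate J (conjugate J x) = - x" if "\<And>x. J (J x) = - x" for x
      by (simp add: conjugate_def inv that linear_neg[OF lin_inv])
    ultimately show ?thesis
      using born metric two_form rec unfolding born_structure_with_def neg by simp
  qed
  moreover have "ce_differential br (pull \<omega>) x y z = 0" for x y z
    using int(1)[of "f x" "f y" "f z"] by (simp add: ce_differential_def pull_def f(3))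
  moreover have "nijenhuis br (conjugate J) x y = 0" for x y
  proof -
    have "f (nijenhuis br (conjugate J) x y) = nijenhuis br' J (f x) (f y)"
      by (simp add: nijenhuis_def linear_add[OF f(1)] linear_diff[OF f(1)] f(3) f_conj)
    then show ?thesis
      using inj[of _ 0] by (simp add: int(2) linear_0[OF f(1)])
  qed
  moreover have sub: "lie_subalgebra br {x. P (f x)}" if "lie_subalgebra br' {x. P x}" for P
    using that unfolding lie_subalgebra_def subspace_def
    by (simp add: linear_0[OF f(1)] linear_add[OF f(1)] linear_scale[OF f(1)] f(3))
  moreover have "conjugate A x = y \<longleftrightarrow> A (f x) = f y" for x y
    by (simp only: inj[of "conjugate A x", symmetric] f_conj)
  ultimately have "integrable_born_structure br (pull g) (pull h) (pull \<omega>)"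
    unfolding integrable_born_structure_def using sub[OF int(3)] sub[OF int(4)]
    by - (rule exI[of _ "conjugate A"], rule exI[of _ "conjugate B"], rule exI[of _ "conjugate J"], simp add: f_neg)
  then show ?thesis by blast
qed

section \<open>Recognising the listed algebras\<close>

text \<open>A four-dimensional Lie algebra is isomorphic to a listed one as soon as a frame has the listed
  brackets; bilinearity and antisymmetry of both brackets do the rest.\<close>

lemma lie_isomorphicI:
  fixes br :: "'a::euclidean_space \<Rightarrow> 'a \<Rightarrow> 'a"
  assumes br: "lie_algebra br" and br': "lie_algebra br'"
    and fr: "frame e\<^sub>1 e\<^sub>2 e\<^sub>3 e\<^sub>4" and dim: "DIM('a) = 4"
    and "br e\<^sub>1 e\<^sub>2 = comb e\<^sub>1 e\<^sub>2 e\<^sub>3 e\<^sub>4 (br' (basis_vec 1) (basis_vec 2))"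
      "br e\<^sub>1 e\<^sub>3 = comb e\<^sub>1 e\<^sub>2 e\<^sub>3 e\<^sub>4 (br' (basis_vec 1) (basis_vec 3))"
      "br e\<^sub>1 e\<^sub>4 = comb e\<^sub>1 e\<^sub>2 e\<^sub>3 e\<^sub>4 (br' (basis_vec 1) (basis_vec 4))"
      "br e\<^sub>2 e\<^sub>3 = comb e\<^sub>1 e\<^sub>2 e\<^sub>3 e\<^sub>4 (br' (basis_vec 2) (basis_vec 3))"
      "br e\<^sub>2 e\<^sub>4 = comb e\<^sub>1 e\<^sub>2 e\<^sub>3 e\<^sub>4 (br' (basis_vec 2) (basis_vec 4))"
      "br e\<^sub>3 e\<^sub>4 = comb e\<^sub>1 e\<^sub>2 e\<^sub>3 e\<^sub>4 (br' (basis_vec 3) (basis_vec 4))"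
  shows "lie_isomorphic br br'"
proof -
  define \<phi> where "\<phi> = comb e\<^sub>1 e\<^sub>2 e\<^sub>3 e\<^sub>4"
  have lin: "linear \<phi>" and bij: "bij \<phi>"
    using linear_comb bij_comb[OF fr dim] by (simp_all add: \<phi>_def)
  note bl = lie_algebraD(1)[OF br] and bl' = lie_algebraD(1)[OF br']
  have expand: "x = x$1 *\<^sub>R basis_vec 1 + x$2 *\<^sub>R basis_vec 2 + x$3 *\<^sub>R basis_vec 3 + x$4 *\<^sub>R basis_vec 4"
    for x :: "real^4"
    by (simp add: vec_eq_iff forall_4 basis_vec_def axis_def)
  have hom: "\<phi> (br' x y) = br (\<phi> x) (\<phi> y)" for x y
  proof -
    have "\<phi> (br' x y) = wedge 1 2 x y *\<^sub>R br e\<^sub>1 e\<^sub>2 + wedge 1 3 x y *\<^sub>R br e\<^sub>1 e\<^sub>3 + wedge 1 4 x y *\<^sub>R br e\<^sub>1 e\<^sub>4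
       + wedge 2 3 x y *\<^sub>R br e\<^sub>2 e\<^sub>3 + wedge 2 4 x y *\<^sub>R br e\<^sub>2 e\<^sub>4 + wedge 3 4 x y *\<^sub>R br e\<^sub>3 e\<^sub>4"
      by (subst expand[of x], subst expand[of y])
        (simp add: bilinear_expand[OF bl'] linear_add[OF lin] linear_scale[OF lin] linear_diff[OF lin]
        linear_neg[OF lin] linear_0[OF lin] wedge_def lie_algebraD(2)[OF br']
        lie_algebraD(3)[OF br', of "basis_vec 2" "basis_vec 1"]
        lie_algebraD(3)[OF br', of "basis_vec 3" "basis_vec 1"]
        lie_algebraD(3)[OF br', of "basis_vec 4" "basis_vec 1"]
        lie_algebraD(3)[OF br', of "basis_vec 3" "basis_vec 2"]
        lie_algebraD(3)[OF br', of "basis_vec 4" "basis_vec 2"]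
        lie_algebraD(3)[OF br', of "basis_vec 4" "basis_vec 3"] assms(5-10) \<phi>_def[symmetric]
        algebra_simps)
    also have "\<dots> = br (\<phi> x) (\<phi> y)"
      unfolding \<phi>_def comb_def
      by (simp add: bilinear_expand[OF bl] wedge_def lie_algebraD(2)[OF br]
        lie_algebraD(3)[OF br, of e\<^sub>2 e\<^sub>1] lie_algebraD(3)[OF br, of e\<^sub>3 e\<^sub>1] lie_algebraD(3)[OF br, of e\<^sub>4 e\<^sub>1]
        lie_algebraD(3)[OF br, of e\<^sub>3 e\<^sub>2] lie_algebraD(3)[OF br, of e\<^sub>4 e\<^sub>2] lie_algebraD(3)[OF br, of e\<^sub>4 e\<^sub>3]
        algebra_simps)
    finally show ?thesis .
  qed
  have inv: "\<phi> (inv \<phi> z) = z" "inv \<phi> (\<phi> x) = x" for x z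
    using bij by (simp_all add: bij_def surj_f_inv_f)
  have "linear (inv \<phi>)" by (rule linear_inv[OF lin bij])
  moreover have "bij (inv \<phi>)" using bij by (rule bij_imp_bij_inv)
  moreover have "inv \<phi> (br x y) = br' (inv \<phi> x) (inv \<phi> y)" for x y
    by (metis hom inv)
  ultimately show ?thesis unfolding lie_isomorphic_def by blast
qed

lemma
  fixes br :: "'a::euclidean_space \<Rightarrow> 'a \<Rightarrow> 'a"
  assumes "lie_algebra br" "frame e\<^sub>1 e\<^sub>2 e\<^sub>3 e\<^sub>4" "DIM('a) = 4"
  shows lie_isomorphic_rh3I:
      "\<lbrakk>br e\<^sub>1 e\<^sub>2 = e\<^sub>3; br e\<^sub>1 e\<^sub>3 = 0; br e\<^sub>1 e\<^sub>4 = 0; br e\<^sub>2 e\<^sub>3 = 0; br e\<^sub>2 e\<^sub>4 = 0; br e\<^sub>3 e\<^sub>4 = 0\<rbrakk>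
        \<Longrightarrow> lie_isomorphic br rh3"
    and lie_isomorphic_rr30I:
      "\<lbrakk>br e\<^sub>1 e\<^sub>2 = e\<^sub>2; br e\<^sub>1 e\<^sub>3 = 0; br e\<^sub>1 e\<^sub>4 = 0; br e\<^sub>2 e\<^sub>3 = 0; br e\<^sub>2 e\<^sub>4 = 0; br e\<^sub>3 e\<^sub>4 = 0\<rbrakk>
        \<Longrightarrow> lie_isomorphic br rr30"
    and lie_isomorphic_r2r2I:
      "\<lbrakk>br e\<^sub>1 e\<^sub>2 = e\<^sub>2; br e\<^sub>1 e\<^sub>3 = 0; br e\<^sub>1 e\<^sub>4 = 0; br e\<^sub>2 e\<^sub>3 = 0; br e\<^sub>2 e\<^sub>4 = 0; br e\<^sub>3 e\<^sub>4 = e\<^sub>4\<rbrakk>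
        \<Longrightarrow> lie_isomorphic br r2r2"
    and lie_isomorphic_r2'I:
      "\<lbrakk>br e\<^sub>1 e\<^sub>2 = 0; br e\<^sub>1 e\<^sub>3 = e\<^sub>3; br e\<^sub>1 e\<^sub>4 = e\<^sub>4; br e\<^sub>2 e\<^sub>3 = e\<^sub>4; br e\<^sub>2 e\<^sub>4 = - e\<^sub>3; br e\<^sub>3 e\<^sub>4 = 0\<rbrakk>
        \<Longrightarrow> lie_isomorphic br r2'"
    and lie_isomorphic_r4m1m1I:
      "\<lbrakk>br e\<^sub>1 e\<^sub>2 = 0; br e\<^sub>1 e\<^sub>3 = 0; br e\<^sub>1 e\<^sub>4 = - e\<^sub>1; br e\<^sub>2 e\<^sub>3 = 0; br e\<^sub>2 e\<^sub>4 = e\<^sub>2; br e\<^sub>3 e\<^sub>4 = e\<^sub>3\<rbrakk>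
        \<Longrightarrow> lie_isomorphic br r4m1m1"
    and lie_isomorphic_d41I:
      "\<lbrakk>br e\<^sub>1 e\<^sub>2 = e\<^sub>3; br e\<^sub>1 e\<^sub>3 = 0; br e\<^sub>1 e\<^sub>4 = - e\<^sub>1; br e\<^sub>2 e\<^sub>3 = 0; br e\<^sub>2 e\<^sub>4 = 0; br e\<^sub>3 e\<^sub>4 = - e\<^sub>3\<rbrakk>
        \<Longrightarrow> lie_isomorphic br d41"
    and lie_isomorphic_d42I:
      "\<lbrakk>br e\<^sub>1 e\<^sub>2 = e\<^sub>3; br e\<^sub>1 e\<^sub>3 = 0; br e\<^sub>1 e\<^sub>4 = - 2 *\<^sub>R e\<^sub>1; br e\<^sub>2 e\<^sub>3 = 0; br e\<^sub>2 e\<^sub>4 = e\<^sub>2;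
        br e\<^sub>3 e\<^sub>4 = - e\<^sub>3\<rbrakk> \<Longrightarrow> lie_isomorphic br d42"
    and lie_isomorphic_d4halfI:
      "\<lbrakk>br e\<^sub>1 e\<^sub>2 = e\<^sub>3; br e\<^sub>1 e\<^sub>3 = 0; br e\<^sub>1 e\<^sub>4 = - (1/2) *\<^sub>R e\<^sub>1; br e\<^sub>2 e\<^sub>3 = 0;
        br e\<^sub>2 e\<^sub>4 = - (1/2) *\<^sub>R e\<^sub>2; br e\<^sub>3 e\<^sub>4 = - e\<^sub>3\<rbrakk> \<Longrightarrow> lie_isomorphic br d4half"
  by (rule lie_isomorphicI[OF assms(1) _ assms(2,3)];
      simp add: lie_algebra_listed comb_def listed_lie_defs wedge_def basis_vec_def axis_def)+

text \<open>The two cases are whether the line \<open>\<real> z\<close> containing the derived ideal is central.  If some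
  \<open>ad x\<close> acts on it nontrivially, scale \<open>x\<close> to \<open>[e,z] = z\<close>; every further vector can be
  corrected by multiples of \<open>e\<close> and \<open>z\<close> to commute with both, and the Jacobi identity then forces
  the corrected vectors to commute with each other.  If \<open>z\<close> is central, a pair with
  \<open>[x,y] \<noteq> 0\<close> spans a Heisenberg algebra with \<open>z\<close>, and a fourth vector is corrected by multiples of
  \<open>x\<close> and \<open>y\<close> to be central.\<close>

lemma one_dim_derived_ideal_cases:
  fixes br :: "'a::euclidean_space \<Rightarrow> 'a \<Rightarrow> 'a"
  assumes br: "lie_algebra br" and dim: "DIM('a) = 4" and nonab: "\<not> abelian_lie br"
    and der: "\<And>x y. \<exists>c. br x y = c *\<^sub>R z"
  shows "lie_isomorphic br rh3 \<or> lie_isomorphic br rr30"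
proof (cases "\<exists>x. br x z \<noteq> 0")
  case True
  note [simp] = bilinear_expand[OF lie_algebraD(1)[OF br]] lie_algebraD(2)[OF br]
  obtain x where x: "br x z \<noteq> 0" using True by blast
  then have z: "z \<noteq> 0" by auto
  obtain l where l: "br x z = l *\<^sub>R z" using der by blast
  define e where "e = (1/l) *\<^sub>R x"
  have ez: "br e z = z" using l x by (auto simp: e_def)
  then have ze: "br z e = - z" using lie_algebraD(3)[OF br, of z e] by simp
  have "a = 0 \<and> b = 0" if "a *\<^sub>R e + b *\<^sub>R z = 0" for a b
  proof -
    have "br e (a *\<^sub>R e + b *\<^sub>R z) = 0" "br (a *\<^sub>R e + b *\<^sub>R z) z = 0" by (simp_all only: that) simp_all
    then show ?thesis using z by (simp add: ez)
  qed
  then obtain u v where fr: "frame e z u v" by (rule extend_pair_to_frame[OF dim])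
  obtain \<alpha> \<beta> \<gamma> \<delta> where ab: "br e u = \<alpha> *\<^sub>R z" "br z u = \<beta> *\<^sub>R z" "br e v = \<gamma> *\<^sub>R z" "br z v = \<delta> *\<^sub>R z"
    using der by metis
  define u' v' where "u' = u + \<beta> *\<^sub>R e + (-\<alpha>) *\<^sub>R z" and "v' = v + \<delta> *\<^sub>R e + (-\<gamma>) *\<^sub>R z"
  have fr': "frame e z u' v'" unfolding u'_def v'_def by (rule frame_shear[OF fr])
  have 0: "br e u' = 0" "br z u' = 0" "br e v' = 0" "br z v' = 0"
    by (simp_all add: u'_def v'_def ab ez ze)
  obtain \<nu> where \<nu>: "br u' v' = \<nu> *\<^sub>R z" using der by blast
  have "br u' v' = 0"
    using lie_algebraD(4)[OF br, of e u' v'] lie_algebraD(3)[OF br, of v' e]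
    by (simp add: 0 \<nu> ez)
  then show ?thesis
    using lie_isomorphic_rr30I[OF br fr' dim] 0 ez by simp
next
  case False
  note [simp] = bilinear_expand[OF lie_algebraD(1)[OF br]] lie_algebraD(2)[OF br]
  have z: "br x z = 0" "br z x = 0" for x
    using False lie_algebraD(3)[OF br, of z x] by auto
  obtain x y where xy: "br x y \<noteq> 0" using nonab unfolding abelian_lie_def by blast
  define w where "w = br x y"
  obtain k where k: "w = k *\<^sub>R z" using der w_def by blast
  have w: "br t w = 0" "br w t = 0" for t by (simp_all add: k z)
  have yx: "br y x = - w" using lie_algebraD(3)[OF br, of y x] by (simp add: w_def)
  have "k \<noteq> 0" using xy k w_def by auto
  have der': "\<exists>c. br s t = c *\<^sub>R w" for s t
  proof -
    obtain m where "br s t = m *\<^sub>R z" using der by blast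
    then have "br s t = (m / k) *\<^sub>R w" using \<open>k \<noteq> 0\<close> by (simp add: k)
    then show ?thesis ..
  qed
  have "a = 0 \<and> b = 0 \<and> c = 0" if "a *\<^sub>R x + b *\<^sub>R y + c *\<^sub>R w = 0" for a b c
  proof -
    have "br x (a *\<^sub>R x + b *\<^sub>R y + c *\<^sub>R w) = 0" "br (a *\<^sub>R x + b *\<^sub>R y + c *\<^sub>R w) y = 0"
      by (simp_all only: that) simp_all
    then have "a = 0" "b = 0" using xy by (simp_all add: w)
    with that show ?thesis using xy w_def by auto
  qed
  then obtain t where fr: "frame x y w t" by (rule extend_triple_to_frame[OF dim])
  obtain \<alpha> \<beta> where ab: "br x t = \<alpha> *\<^sub>R w" "br y t = \<beta> *\<^sub>R w" using der' by metis
  define t' where "t' = t + \<beta> *\<^sub>R x + (-\<alpha>) *\<^sub>R y"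
  have fr': "frame x y w t'" using frame_shear[OF fr, of 0 0 \<beta> "-\<alpha>"] by (simp add: t'_def)
  have "br x t' = 0" "br y t' = 0" by (simp_all add: t'_def ab yx flip: w_def)
  then show ?thesis
    using lie_isomorphic_rh3I[OF br fr' dim] w by (simp add: w_def)
qed

text \<open>Here \<open>D\<close> and \<open>M\<close> act on the abelian ideal spanned by \<open>\<xi>\<close> and \<open>\<eta>\<close> as multiplication by \<open>1\<close>
  and by the generator of \<open>K = \<real>[M]/(M\<^sup>2 - c)\<close> on \<open>K\<close> itself, so the hypotheses describe the affine
  Lie algebra of \<open>K\<close>.  For \<open>c > 0\<close> the two idempotents of \<open>K \<cong> \<real> \<times> \<real>\<close> split it into two
  nonabelian planes, for \<open>c < 0\<close> it is the affine algebra of the complex numbers, and for \<open>c = 0\<close>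
  that of the dual numbers.\<close>

lemma affine_algebra_cases:
  fixes br :: "'a::euclidean_space \<Rightarrow> 'a \<Rightarrow> 'a" and c :: real
  assumes br: "lie_algebra br" and dim: "DIM('a) = 4" and fr: "frame D M \<xi> \<eta>"
    and b: "br D M = 0" "br D \<xi> = \<xi>" "br D \<eta> = \<eta>" "br M \<xi> = \<eta>" "br M \<eta> = c *\<^sub>R \<xi>" "br \<xi> \<eta> = 0"
  shows "lie_isomorphic br r2r2 \<or> lie_isomorphic br r2' \<or> lie_isomorphic br d41"
proof -
  note [simp] = bilinear_expand[OF lie_algebraD(1)[OF br]] lie_algebraD(2)[OF br]
  have [simp]: "br D M = 0" "br D \<xi> = \<xi>" "br D \<eta> = \<eta>" "br M \<xi> = \<eta>" "br M \<eta> = c *\<^sub>R \<xi>" "br \<xi> \<eta> = 0"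
      "br M D = 0" "br \<xi> D = - \<xi>" "br \<eta> D = - \<eta>" "br \<xi> M = - \<eta>" "br \<eta> M = - c *\<^sub>R \<xi>" "br \<eta> \<xi> = 0"
    using b lie_algebraD(3)[OF br, of M D] lie_algebraD(3)[OF br, of \<xi> D] lie_algebraD(3)[OF br, of \<eta> D]
      lie_algebraD(3)[OF br, of \<xi> M] lie_algebraD(3)[OF br, of \<eta> M] lie_algebraD(3)[OF br, of \<eta> \<xi>]
    by simp_all
  consider "c > 0" | "c < 0" | "c = 0" by linarith
  then show ?thesis
  proof cases
    case 1
    define m where "m = 1 / sqrt c"
    have m: "m \<noteq> 0" "m * m * c = 1" using 1 by (simp_all add: m_def)
    have m2: "m * (m * c) = 1" "m * (c * m) = 1" "c * (m * m) = 1" using m by (simp_all add: algebra_simps)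
    define D\<^sub>p D\<^sub>n \<xi>\<^sub>p \<xi>\<^sub>n where "D\<^sub>p = D + m *\<^sub>R M" and "D\<^sub>n = D - m *\<^sub>R M"
      and "\<xi>\<^sub>p = \<xi> + m *\<^sub>R \<eta>" and "\<xi>\<^sub>n = \<xi> - m *\<^sub>R \<eta>"
    note e = this
    have twice: "(m * 2) *\<^sub>R \<eta> = m *\<^sub>R \<eta> + m *\<^sub>R \<eta>"
      by (simp flip: scaleR_add_left)
    have "br D\<^sub>p \<xi>\<^sub>p = 2 *\<^sub>R \<xi>\<^sub>p" "br D\<^sub>n \<xi>\<^sub>n = 2 *\<^sub>R \<xi>\<^sub>n" "br D\<^sub>p \<xi>\<^sub>n = 0" "br D\<^sub>n \<xi>\<^sub>p = 0"
      "br D\<^sub>p D\<^sub>n = 0" "br \<xi>\<^sub>p \<xi>\<^sub>n = 0"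
      by (simp_all add: e m2 algebra_simps scaleR_2 twice)
    note br_pm = this lie_algebraD(3)[OF br, of \<xi>\<^sub>p D\<^sub>n]
    have "frame ((1/2) *\<^sub>R D\<^sub>p) \<xi>\<^sub>p ((1/2) *\<^sub>R D\<^sub>n) \<xi>\<^sub>n"
    proof (rule frameI)
      fix p q r s
      assume *: "p *\<^sub>R (1/2) *\<^sub>R D\<^sub>p + q *\<^sub>R \<xi>\<^sub>p + r *\<^sub>R (1/2) *\<^sub>R D\<^sub>n + s *\<^sub>R \<xi>\<^sub>n = 0"
      have "((p + r)/2) *\<^sub>R D + (m * (p - r)/2) *\<^sub>R M + (q + s) *\<^sub>R \<xi> + (m * (q - s)) *\<^sub>R \<eta> = 0"
        using * by (simp add: e algebra_simps add_divide_distrib diff_divide_distrib)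
      from frameD[OF fr this] m(1) show "p = 0 \<and> q = 0 \<and> r = 0 \<and> s = 0" by simp
    qed
    from lie_isomorphic_r2r2I[OF br this dim] have "lie_isomorphic br r2r2"
      by (simp add: br_pm)
    then show ?thesis by simp
  next
    case 2
    define m where "m = 1 / sqrt (- c)"
    have m: "m \<noteq> 0" "m * m * c = - 1" using 2 by (simp_all add: m_def field_simps)
    then have m2: "m * (m * c) = - 1" by simp
    have "frame D (m *\<^sub>R M) \<xi> (m *\<^sub>R \<eta>)"
    proof (rule frameI)
      fix p q r s assume *: "p *\<^sub>R D + q *\<^sub>R m *\<^sub>R M + r *\<^sub>R \<xi> + s *\<^sub>R m *\<^sub>R \<eta> = 0"
      then have "p *\<^sub>R D + (q * m) *\<^sub>R M + r *\<^sub>R \<xi> + (s * m) *\<^sub>R \<eta> = 0" by simp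
      from frameD[OF fr this] m(1) show "p = 0 \<and> q = 0 \<and> r = 0 \<and> s = 0" by simp
    qed
    from lie_isomorphic_r2'I[OF br this dim] have "lie_isomorphic br r2'"
      by (simp add: m2)
    then show ?thesis by simp
  next
    case 3
    have "frame \<xi> (- M) \<eta> D"
    proof (rule frameI)
      fix p q r s assume *: "p *\<^sub>R \<xi> + q *\<^sub>R - M + r *\<^sub>R \<eta> + s *\<^sub>R D = 0"
      then have "s *\<^sub>R D + (- q) *\<^sub>R M + p *\<^sub>R \<xi> + r *\<^sub>R \<eta> = 0" by (simp add: algebra_simps)
      from frameD[OF fr this] show "p = 0 \<and> q = 0 \<and> r = 0 \<and> s = 0" by simp
    qed
    from lie_isomorphic_d41I[OF br this dim] have "lie_isomorphic br d41"
      using 3 by simp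
    then show ?thesis by simp
  qed
qed

text \<open>The frame \<open>(x, y, X, Y)\<close> identifies the Lie algebra with \<open>K\<^sup>2\<close>, \<open>K = \<real>[M]/(M\<^sup>2 - c)\<close>, where
  \<open>x\<close>, \<open>X\<close> are the standard basis, \<open>y = M x\<close> and \<open>Y = M X\<close>.  With
  \<open>s = s\<^sub>0 + s\<^sub>1 M\<close> and \<open>t = t\<^sub>0 + t\<^sub>1 M\<close> the vectors are \<open>\<xi> = (s,t)\<close> and \<open>\<eta> = M \<xi>\<close>, and the bracket
  is \<open>[(a,b),(a',b')] = - (a b' - b a') \<xi>\<close>.

  If \<open>\<alpha> t - \<beta> s = - 1\<close> for some \<open>\<alpha>\<close>, \<open>\<beta>\<close> in \<open>K\<close>, then \<open>D = (\<alpha>,\<beta>)\<close> and \<open>M D\<close> act on \<open>\<xi>\<close>, \<open>\<eta>\<close> as in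
  \<open>affine_algebra_cases\<close>, and they commute because \<open>det(D, M D) = 0\<close>.  Such a pair exists if one of
  \<open>s\<close>, \<open>t\<close>, \<open>s + t\<close> is a unit, that is, has nonzero norm \<open>N(a\<^sub>0 + a\<^sub>1 M) = a\<^sub>0\<^sup>2 - c a\<^sub>1\<^sup>2\<close>: divide the
  conjugate by the norm.  If all three norms vanish, \<open>\<xi>\<close> and \<open>\<eta>\<close> are dependent and the
  derived ideal is contained in a line.\<close>

lemma planar_algebra_cases:
  fixes br :: "'a::euclidean_space \<Rightarrow> 'a \<Rightarrow> 'a" and c :: real
  assumes br: "lie_algebra br" and dim: "DIM('a) = 4" and nonab: "\<not> abelian_lie br"
    and fr: "frame x y X Y"
    and \<xi>: "\<xi> = s\<^sub>0 *\<^sub>R x + s\<^sub>1 *\<^sub>R y + t\<^sub>0 *\<^sub>R X + t\<^sub>1 *\<^sub>R Y"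
    and \<eta>: "\<eta> = (c * s\<^sub>1) *\<^sub>R x + s\<^sub>0 *\<^sub>R y + (c * t\<^sub>1) *\<^sub>R X + t\<^sub>0 *\<^sub>R Y"
    and b: "br x y = 0" "br X Y = 0" "br x X = - \<xi>" "br x Y = - \<eta>" "br y X = - \<eta>" "br y Y = - c *\<^sub>R \<xi>"
  shows "lie_isomorphic br rh3 \<or> lie_isomorphic br rr30 \<or> lie_isomorphic br r2r2 \<or>
    lie_isomorphic br r2' \<or> lie_isomorphic br d41"
proof -
  define pt where "pt a\<^sub>0 a\<^sub>1 b\<^sub>0 b\<^sub>1 = a\<^sub>0 *\<^sub>R x + a\<^sub>1 *\<^sub>R y + b\<^sub>0 *\<^sub>R X + b\<^sub>1 *\<^sub>R Y" for a\<^sub>0 a\<^sub>1 b\<^sub>0 b\<^sub>1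
  have bracket: "br (pt a\<^sub>0 a\<^sub>1 b\<^sub>0 b\<^sub>1) (pt c\<^sub>0 c\<^sub>1 d\<^sub>0 d\<^sub>1) =
      (b\<^sub>0 * c\<^sub>0 + c * b\<^sub>1 * c\<^sub>1 - a\<^sub>0 * d\<^sub>0 - c * a\<^sub>1 * d\<^sub>1) *\<^sub>R \<xi> +
      (b\<^sub>0 * c\<^sub>1 + b\<^sub>1 * c\<^sub>0 - a\<^sub>0 * d\<^sub>1 - a\<^sub>1 * d\<^sub>0) *\<^sub>R \<eta>" for a\<^sub>0 a\<^sub>1 b\<^sub>0 b\<^sub>1 c\<^sub>0 c\<^sub>1 d\<^sub>0 d\<^sub>1
  proof -
    have "br y x = 0" "br Y X = 0" "br X x = \<xi>" "br Y x = \<eta>" "br X y = \<eta>" "br Y y = c *\<^sub>R \<xi>"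
      using b lie_algebraD(3)[OF br, of y x] lie_algebraD(3)[OF br, of Y X] lie_algebraD(3)[OF br, of X x]
        lie_algebraD(3)[OF br, of Y x] lie_algebraD(3)[OF br, of X y] lie_algebraD(3)[OF br, of Y y]
      by simp_all
    then show ?thesis
      by (simp add: pt_def b bilinear_expand[OF lie_algebraD(1)[OF br]] lie_algebraD(2)[OF br] algebra_simps)
  qed
  have \<xi>': "\<xi> = pt s\<^sub>0 s\<^sub>1 t\<^sub>0 t\<^sub>1" and \<eta>': "\<eta> = pt (c * s\<^sub>1) s\<^sub>0 (c * t\<^sub>1) t\<^sub>0"
    by (simp_all add: pt_def \<xi> \<eta>)
  have unimodular: ?thesis
    if u: "\<alpha>\<^sub>0 * t\<^sub>0 + c * \<alpha>\<^sub>1 * t\<^sub>1 - \<beta>\<^sub>0 * s\<^sub>0 - c * \<beta>\<^sub>1 * s\<^sub>1 = - 1"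
      "\<alpha>\<^sub>0 * t\<^sub>1 + \<alpha>\<^sub>1 * t\<^sub>0 - \<beta>\<^sub>0 * s\<^sub>1 - \<beta>\<^sub>1 * s\<^sub>0 = 0" for \<alpha>\<^sub>0 \<alpha>\<^sub>1 \<beta>\<^sub>0 \<beta>\<^sub>1
  proof -
    define D M where "D = pt \<alpha>\<^sub>0 \<alpha>\<^sub>1 \<beta>\<^sub>0 \<beta>\<^sub>1" and "M = pt (c * \<alpha>\<^sub>1) \<alpha>\<^sub>0 (c * \<beta>\<^sub>1) \<beta>\<^sub>0"
    have "br D M = 0" by (simp add: D_def M_def bracket algebra_simps)
    moreover have D\<xi>: "br D \<xi> = \<xi>"
    proof -
      have "br D \<xi> = (- (\<alpha>\<^sub>0 * t\<^sub>0 + c * \<alpha>\<^sub>1 * t\<^sub>1 - \<beta>\<^sub>0 * s\<^sub>0 - c * \<beta>\<^sub>1 * s\<^sub>1)) *\<^sub>R \<xi>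
          + (- (\<alpha>\<^sub>0 * t\<^sub>1 + \<alpha>\<^sub>1 * t\<^sub>0 - \<beta>\<^sub>0 * s\<^sub>1 - \<beta>\<^sub>1 * s\<^sub>0)) *\<^sub>R \<eta>"
        unfolding D_def by (subst (1) \<xi>', subst bracket) (simp add: algebra_simps)
      then show ?thesis by (simp only: u) simp
    qed
    moreover have D\<eta>: "br D \<eta> = \<eta>"
    proof -
      have "br D \<eta> = (- c * (\<alpha>\<^sub>0 * t\<^sub>1 + \<alpha>\<^sub>1 * t\<^sub>0 - \<beta>\<^sub>0 * s\<^sub>1 - \<beta>\<^sub>1 * s\<^sub>0)) *\<^sub>R \<xi>
          + (- (\<alpha>\<^sub>0 * t\<^sub>0 + c * \<alpha>\<^sub>1 * t\<^sub>1 - \<beta>\<^sub>0 * s\<^sub>0 - c * \<beta>\<^sub>1 * s\<^sub>1)) *\<^sub>R \<eta>"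
        unfolding D_def by (subst (1) \<eta>', subst bracket) (simp add: algebra_simps)
      then show ?thesis by (simp only: u) simp
    qed
    moreover have M\<xi>: "br M \<xi> = \<eta>"
    proof -
      have "br M \<xi> = (- c * (\<alpha>\<^sub>0 * t\<^sub>1 + \<alpha>\<^sub>1 * t\<^sub>0 - \<beta>\<^sub>0 * s\<^sub>1 - \<beta>\<^sub>1 * s\<^sub>0)) *\<^sub>R \<xi>
          + (- (\<alpha>\<^sub>0 * t\<^sub>0 + c * \<alpha>\<^sub>1 * t\<^sub>1 - \<beta>\<^sub>0 * s\<^sub>0 - c * \<beta>\<^sub>1 * s\<^sub>1)) *\<^sub>R \<eta>"
        unfolding M_def by (subst (1) \<xi>', subst bracket) (simp add: algebra_simps)
      then show ?thesis by (simp only: u) simp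
    qed
    moreover have M\<eta>: "br M \<eta> = c *\<^sub>R \<xi>"
    proof -
      have "br M \<eta> = (- c * (\<alpha>\<^sub>0 * t\<^sub>0 + c * \<alpha>\<^sub>1 * t\<^sub>1 - \<beta>\<^sub>0 * s\<^sub>0 - c * \<beta>\<^sub>1 * s\<^sub>1)) *\<^sub>R \<xi>
          + (- c * (\<alpha>\<^sub>0 * t\<^sub>1 + \<alpha>\<^sub>1 * t\<^sub>0 - \<beta>\<^sub>0 * s\<^sub>1 - \<beta>\<^sub>1 * s\<^sub>0)) *\<^sub>R \<eta>"
        unfolding M_def by (subst (1) \<eta>', subst bracket) (simp add: algebra_simps)
      then show ?thesis by (simp only: u) simp
    qed
    moreover have "br \<xi> \<eta> = 0"
      by (subst \<xi>', subst \<eta>', subst bracket) (simp add: algebra_simps)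
    moreover have "frame D M \<xi> \<eta>"
    proof -
      have indep: "e = 0 \<and> f = 0" if "e *\<^sub>R \<xi> + f *\<^sub>R \<eta> = 0" for e f
      proof -
        have "(e * s\<^sub>0 + f * c * s\<^sub>1) *\<^sub>R x + (e * s\<^sub>1 + f * s\<^sub>0) *\<^sub>R y
            + (e * t\<^sub>0 + f * c * t\<^sub>1) *\<^sub>R X + (e * t\<^sub>1 + f * t\<^sub>0) *\<^sub>R Y = 0"
          using that by (simp add: \<xi> \<eta> algebra_simps)
        note 0 = frameD[OF fr this]
        have "e = 0" using 0 u by algebra
        moreover have "f = 0" using 0 u by algebra
        ultimately show ?thesis ..
      qed
      show ?thesis
      proof (rule frameI)
        fix p q r s assume *: "p *\<^sub>R D + q *\<^sub>R M + r *\<^sub>R \<xi> + s *\<^sub>R \<eta> = 0"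
        have "br (p *\<^sub>R D + q *\<^sub>R M + r *\<^sub>R \<xi> + s *\<^sub>R \<eta>) \<xi> = 0"
          by (simp only: *) (simp add: bilinear_expand[OF lie_algebraD(1)[OF br]])
        then have "p *\<^sub>R \<xi> + q *\<^sub>R \<eta> = 0"
          using \<open>br \<xi> \<eta> = 0\<close> lie_algebraD(3)[OF br, of \<eta> \<xi>]
          by (simp add: bilinear_expand[OF lie_algebraD(1)[OF br]] lie_algebraD(2)[OF br] D\<xi> M\<xi>)
        with indep have "p = 0" "q = 0" by blast+
        with * indep show "p = 0 \<and> q = 0 \<and> r = 0 \<and> s = 0" by simp
      qed
    qed
    ultimately show ?thesis
      using affine_algebra_cases[OF br dim] by blast
  qed
  have dependent: ?thesis if \<eta>\<xi>: "\<eta> = l *\<^sub>R \<xi>" for l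
  proof -
    have "\<exists>k. br u v = k *\<^sub>R \<xi>" for u v
    proof -
      obtain a\<^sub>0 a\<^sub>1 b\<^sub>0 b\<^sub>1 c\<^sub>0 c\<^sub>1 d\<^sub>0 d\<^sub>1 where "u = pt a\<^sub>0 a\<^sub>1 b\<^sub>0 b\<^sub>1" "v = pt c\<^sub>0 c\<^sub>1 d\<^sub>0 d\<^sub>1"
        using frame_span[OF fr dim] unfolding pt_def by metis
      then show ?thesis
        by (simp add: bracket \<eta>\<xi> flip: scaleR_add_left)
    qed
    then show ?thesis using one_dim_derived_ideal_cases[OF br dim nonab] by blast
  qed
  \<comment> \<open>\<open>Ns\<close> and \<open>Nt\<close> are the norms of \<open>s\<close> and \<open>t\<close>, and \<open>B\<close> polarises the norm:
    \<open>N(s + t) = Ns + 2 B + Nt\<close>.\<close>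
  define Ns Nt B \<delta> where "Ns = s\<^sub>0 * s\<^sub>0 - c * s\<^sub>1 * s\<^sub>1" and "Nt = t\<^sub>0 * t\<^sub>0 - c * t\<^sub>1 * t\<^sub>1"
    and "B = s\<^sub>0 * t\<^sub>0 - c * s\<^sub>1 * t\<^sub>1" and "\<delta> = s\<^sub>1 * t\<^sub>0 - s\<^sub>0 * t\<^sub>1"
  note N_defs = Ns_def Nt_def B_def \<delta>_def
  consider "Ns \<noteq> 0" | "Nt \<noteq> 0" | "Ns = 0" "Nt = 0" "B \<noteq> 0" | "Ns = 0" "Nt = 0" "B = 0"
    by blast
  then show ?thesis
  proof cases
    case 1
    show ?thesis
      by (rule unimodular[of 0 0 "s\<^sub>0 / Ns" "- s\<^sub>1 / Ns"]) (use 1 in \<open>simp_all add: Ns_def divide_simps\<close>)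
  next
    case 2
    show ?thesis
      by (rule unimodular[of "- t\<^sub>0 / Nt" "t\<^sub>1 / Nt" 0 0]) (use 2 in \<open>simp_all add: Nt_def divide_simps\<close>)
  next
    case 3
    have "(s\<^sub>0 + t\<^sub>0) * (s\<^sub>0 + t\<^sub>0) - c * (s\<^sub>1 + t\<^sub>1) * (s\<^sub>1 + t\<^sub>1) = 2 * B"
      using 3 unfolding N_defs by (simp add: algebra_simps)
    moreover define k where "k = 1 / (2 * B)"
    moreover from this have "2 * B * k = 1" using 3(3) by simp
    ultimately have "((s\<^sub>0 + t\<^sub>0) * (s\<^sub>0 + t\<^sub>0) - c * (s\<^sub>1 + t\<^sub>1) * (s\<^sub>1 + t\<^sub>1)) * k = 1"
      by simp
    then show ?thesis
      by (intro unimodular[of "- (s\<^sub>0 + t\<^sub>0) * k" "(s\<^sub>1 + t\<^sub>1) * k" "(s\<^sub>0 + t\<^sub>0) * k" "- (s\<^sub>1 + t\<^sub>1) * k"])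
        (simp_all add: algebra_simps)
  next
    case 4
    \<comment> \<open>\<open>\<delta>\<close> is the coefficient of \<open>M\<close> in the conjugate of \<open>s\<close> times \<open>t\<close>, up to sign, and
      \<open>B\<^sup>2 - c \<delta>\<^sup>2\<close> is its norm \<open>Ns Nt\<close>.\<close>
    have "c * (\<delta> * \<delta>) = 0" using 4 unfolding N_defs by algebra
    moreover have "\<delta> = 0" if "c = 0" using 4 that unfolding N_defs by simp
    ultimately have \<delta>: "\<delta> = 0" by auto
    consider "s\<^sub>1 \<noteq> 0" | "t\<^sub>1 \<noteq> 0" | "s\<^sub>1 = 0" "t\<^sub>1 = 0" by blast
    then show ?thesis
    proof cases
      case 1
      have "c * s\<^sub>1 = s\<^sub>0 / s\<^sub>1 * s\<^sub>0" "s\<^sub>0 = s\<^sub>0 / s\<^sub>1 * s\<^sub>1" "c * t\<^sub>1 = s\<^sub>0 / s\<^sub>1 * t\<^sub>0" "t\<^sub>0 = s\<^sub>0 / s\<^sub>1 * t\<^sub>1"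
        using 4 \<delta> 1 unfolding N_defs by (simp_all add: field_simps)
      then have "\<eta> = (s\<^sub>0 / s\<^sub>1) *\<^sub>R \<xi>" unfolding \<xi> \<eta> by (simp add: scaleR_add_right)
      then show ?thesis by (rule dependent)
    next
      case 2
      have "c * s\<^sub>1 = t\<^sub>0 / t\<^sub>1 * s\<^sub>0" "s\<^sub>0 = t\<^sub>0 / t\<^sub>1 * s\<^sub>1" "c * t\<^sub>1 = t\<^sub>0 / t\<^sub>1 * t\<^sub>0" "t\<^sub>0 = t\<^sub>0 / t\<^sub>1 * t\<^sub>1"
        using 4 \<delta> 2 unfolding N_defs by (simp_all add: field_simps)
      then have "\<eta> = (t\<^sub>0 / t\<^sub>1) *\<^sub>R \<xi>" unfolding \<xi> \<eta> by (simp add: scaleR_add_right)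
      then show ?thesis by (rule dependent)
    next
      case 3
      with 4 have "s\<^sub>0 = 0" "t\<^sub>0 = 0" unfolding N_defs by simp_all
      with 3 have "\<eta> = 0 *\<^sub>R \<xi>" by (simp add: \<eta>)
      then show ?thesis by (rule dependent)
    qed
  qed
qed

section \<open>The bracket in a frame adapted to the splitting\<close>

text \<open>The Jacobi identity for the four triples of frame vectors, as vector equations in the coordinate
  vectors of the six brackets.\<close>

lemma jacobi_coordinates:
  assumes br: "lie_algebra br" and fr: "frame e\<^sub>1 e\<^sub>2 e\<^sub>3 e\<^sub>4"
    and b: "br e\<^sub>1 e\<^sub>2 = comb e\<^sub>1 e\<^sub>2 e\<^sub>3 e\<^sub>4 a" "br e\<^sub>1 e\<^sub>3 = comb e\<^sub>1 e\<^sub>2 e\<^sub>3 e\<^sub>4 b"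
      "br e\<^sub>1 e\<^sub>4 = comb e\<^sub>1 e\<^sub>2 e\<^sub>3 e\<^sub>4 c" "br e\<^sub>2 e\<^sub>3 = comb e\<^sub>1 e\<^sub>2 e\<^sub>3 e\<^sub>4 d"
      "br e\<^sub>2 e\<^sub>4 = comb e\<^sub>1 e\<^sub>2 e\<^sub>3 e\<^sub>4 e" "br e\<^sub>3 e\<^sub>4 = comb e\<^sub>1 e\<^sub>2 e\<^sub>3 e\<^sub>4 f"
  shows "(d$2 + b$1) *\<^sub>R a + (d$3 - a$1) *\<^sub>R b + d$4 *\<^sub>R c - (b$3 + a$2) *\<^sub>R d - b$4 *\<^sub>R e + a$4 *\<^sub>R f = 0"
    and "(e$2 + c$1) *\<^sub>R a + e$3 *\<^sub>R b + (e$4 - a$1) *\<^sub>R c - c$3 *\<^sub>R d - (c$4 + a$2) *\<^sub>R e - a$3 *\<^sub>R f = 0"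
    and "f$2 *\<^sub>R a + (f$3 + c$1) *\<^sub>R b + (f$4 - b$1) *\<^sub>R c + c$2 *\<^sub>R d - b$2 *\<^sub>R e - (c$4 + b$3) *\<^sub>R f = 0"
    and "e$1 *\<^sub>R b - f$1 *\<^sub>R a - d$1 *\<^sub>R c + (f$3 + e$2) *\<^sub>R d + (f$4 - d$2) *\<^sub>R e - (e$4 + d$3) *\<^sub>R f = 0"
proof -
  note bl = bilinear_expand[OF lie_algebraD(1)[OF br]]
  define \<phi> where "\<phi> = comb e\<^sub>1 e\<^sub>2 e\<^sub>3 e\<^sub>4"
  have lin: "linear \<phi>" unfolding \<phi>_def by (rule linear_comb)
  note \<phi> = linear_add[OF lin] linear_diff[OF lin] linear_scale[OF lin]
  have zero: "x = 0" if "\<phi> x = 0" for x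
    using frameD[OF fr that[unfolded \<phi>_def comb_def]] by (simp add: vec_eq_iff forall_4)
  note b' = b[folded \<phi>_def]
  have anti: "br e\<^sub>2 e\<^sub>1 = - \<phi> a" "br e\<^sub>3 e\<^sub>1 = - \<phi> b" "br e\<^sub>4 e\<^sub>1 = - \<phi> c"
    "br e\<^sub>3 e\<^sub>2 = - \<phi> d" "br e\<^sub>4 e\<^sub>2 = - \<phi> e" "br e\<^sub>4 e\<^sub>3 = - \<phi> f"
    unfolding lie_algebraD(3)[OF br, of e\<^sub>2 e\<^sub>1] lie_algebraD(3)[OF br, of e\<^sub>3 e\<^sub>1] lie_algebraD(3)[OF br, of e\<^sub>4 e\<^sub>1]
      lie_algebraD(3)[OF br, of e\<^sub>3 e\<^sub>2] lie_algebraD(3)[OF br, of e\<^sub>4 e\<^sub>2] lie_algebraD(3)[OF br, of e\<^sub>4 e\<^sub>3]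
    by (simp_all add: b')
  have L: "br e\<^sub>1 (\<phi> x) = x$2 *\<^sub>R \<phi> a + x$3 *\<^sub>R \<phi> b + x$4 *\<^sub>R \<phi> c"
    "br e\<^sub>2 (\<phi> x) = x$3 *\<^sub>R \<phi> d + x$4 *\<^sub>R \<phi> e - x$1 *\<^sub>R \<phi> a"
    "br e\<^sub>3 (\<phi> x) = x$4 *\<^sub>R \<phi> f - x$1 *\<^sub>R \<phi> b - x$2 *\<^sub>R \<phi> d"
    "br e\<^sub>4 (\<phi> x) = - (x$1 *\<^sub>R \<phi> c) - x$2 *\<^sub>R \<phi> e - x$3 *\<^sub>R \<phi> f" for x
    unfolding \<phi>_def comb_def[of _ _ _ _ x] 
    by (simp_all add: bl lie_algebraD(2)[OF br] b'[unfolded \<phi>_def] anti[unfolded \<phi>_def])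
  note jac = lie_algebraD(4)[OF br]
  show "(d$2 + b$1) *\<^sub>R a + (d$3 - a$1) *\<^sub>R b + d$4 *\<^sub>R c - (b$3 + a$2) *\<^sub>R d - b$4 *\<^sub>R e + a$4 *\<^sub>R f = 0"
    by (rule zero) (use jac[of e\<^sub>1 e\<^sub>2 e\<^sub>3] in \<open>simp add: anti b' bl L \<phi> algebra_simps\<close>)
  show "(e$2 + c$1) *\<^sub>R a + e$3 *\<^sub>R b + (e$4 - a$1) *\<^sub>R c - c$3 *\<^sub>R d - (c$4 + a$2) *\<^sub>R e - a$3 *\<^sub>R f = 0"
    by (rule zero) (use jac[of e\<^sub>1 e\<^sub>2 e\<^sub>4] in \<open>simp add: anti b' bl L \<phi> algebra_simps\<close>)
  show "f$2 *\<^sub>R a + (f$3 + c$1) *\<^sub>R b + (f$4 - b$1) *\<^sub>R c + c$2 *\<^sub>R d - b$2 *\<^sub>R e - (c$4 + b$3) *\<^sub>R f = 0"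
    by (rule zero) (use jac[of e\<^sub>1 e\<^sub>3 e\<^sub>4] in \<open>simp add: anti b' bl L \<phi> algebra_simps\<close>)
  show "e$1 *\<^sub>R b - f$1 *\<^sub>R a - d$1 *\<^sub>R c + (f$3 + e$2) *\<^sub>R d + (f$4 - d$2) *\<^sub>R e - (e$4 + d$3) *\<^sub>R f = 0"
    by (rule zero) (use jac[of e\<^sub>2 e\<^sub>3 e\<^sub>4] in \<open>simp add: anti b' bl L \<phi> algebra_simps\<close>)
qed

locale born_lie_algebra =
  fixes br :: "'a::euclidean_space \<Rightarrow> 'a \<Rightarrow> 'a" and h :: "'a \<Rightarrow> 'a \<Rightarrow> real"
    and J :: "'a \<Rightarrow> 'a" and V W :: "'a set"
  assumes dim: "DIM('a) = 4"
    and br: "lie_algebra br"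
    and splitting: "born_splitting h J V W"
    and closed: "\<And>x y z. ce_differential br (\<lambda>x y. h (J x) y) x y z = 0"
    and nijenhuis: "\<And>x y. nijenhuis br J x y = 0"
    and subV: "lie_subalgebra br V" and subW: "lie_subalgebra br W"
begin

lemma h: "bilinear h" "h x y = h y x"
  using splitting unfolding born_splitting_def pseudo_metric_def by blast+

lemma J: "linear J" "J (J x) = - x" "h (J x) (J y) = h x y"
  using splitting unfolding born_splitting_def by blast+

lemma V: "subspace V" "x \<in> V \<Longrightarrow> y \<in> V \<Longrightarrow> br x y \<in> V"
  using subV unfolding lie_subalgebra_def by blast+

lemma W: "subspace W" "x \<in> W \<Longrightarrow> y \<in> W \<Longrightarrow> br x y \<in> W"
  using subW unfolding lie_subalgebra_def by blast+

lemma JV: "v \<in> V \<Longrightarrow> J v \<in> W" and V_eq: "J ` V = W"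
  using splitting unfolding born_splitting_def by blast+

lemma V_Int_W: "V \<inter> W = {0}" and decompose: "\<exists>v\<in>V. \<exists>w\<in>W. x = v + w"
    and orthogonal: "v \<in> V \<Longrightarrow> w \<in> W \<Longrightarrow> h v w = 0"
  using splitting unfolding born_splitting_def by blast+

text \<open>The roles of the two leaves are symmetric, so a nonabelian leaf can be taken to be \<open>V\<close>.\<close>

lemma swap: "born_lie_algebra br h J W V"
proof -
  have orth: "\<forall>w\<in>W. \<forall>v\<in>V. h w v = 0"
    using orthogonal h(2) by (metis (full_types))
  have dec: "\<forall>x. \<exists>w\<in>W. \<exists>v\<in>V. x = w + v"
  proof
    fix x
    obtain v w where "v \<in> V" "w \<in> W" "x = v + w" using decompose by blast
    then show "\<exists>w\<in>W. \<exists>v\<in>V. x = w + v" by (intro bexI) (auto simp: add.commute)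
  qed
  have int: "W \<inter> V = {0}" using V_Int_W by blast
  have "born_splitting h J W V"
    unfolding born_splitting_def
    using splitting[unfolded born_splitting_def] orth dec int
    by (elim conjE, intro conjI)
  then show ?thesis
    using dim br closed nijenhuis subV subW by (intro born_lie_algebra.intro)
qed

lemma nondegenerate_on_leaf:
  assumes "v \<in> V" "v \<noteq> 0"
  obtains u where "u \<in> V" "h v u \<noteq> 0"
proof -
  have "nondegenerate h"
    using splitting unfolding born_splitting_def pseudo_metric_def by blast
  then obtain x where "h v x \<noteq> 0" using assms(2) unfolding nondegenerate_def by blast
  moreover obtain u w where "u \<in> V" "w \<in> W" "x = u + w" using decompose by blast
  ultimately show ?thesis
    using that orthogonal[OF assms(1)] by (simp add: bilinear_radd[OF h(1)])
qed

lemma leaf_frame: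
  assumes v: "v\<^sub>1 \<in> V" "v\<^sub>2 \<in> V"
    and ind: "\<And>a b. a *\<^sub>R v\<^sub>1 + b *\<^sub>R v\<^sub>2 = 0 \<Longrightarrow> a = 0 \<and> b = 0"
  shows "frame v\<^sub>1 v\<^sub>2 (J v\<^sub>1) (J v\<^sub>2)"
proof (rule frameI)
  fix a b c d
  assume *: "a *\<^sub>R v\<^sub>1 + b *\<^sub>R v\<^sub>2 + c *\<^sub>R J v\<^sub>1 + d *\<^sub>R J v\<^sub>2 = 0"
  define x y where "x = a *\<^sub>R v\<^sub>1 + b *\<^sub>R v\<^sub>2" and "y = c *\<^sub>R v\<^sub>1 + d *\<^sub>R v\<^sub>2"
  have mem: "x \<in> V" "y \<in> V" using v V(1) by (simp_all add: x_def y_def subspace_add subspace_scale)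
  have "x + J y = 0" using * by (simp add: x_def y_def linear_add[OF J(1)] linear_scale[OF J(1)] add.assoc)
  then have "x = - J y" by (simp add: add_eq_0_iff2)
  then have "x \<in> W" using JV[OF mem(2)] W(1) by (simp add: subspace_neg)
  then have "x = 0" using V_Int_W mem by blast
  moreover have "y = 0"
    using \<open>x = - J y\<close> \<open>x = 0\<close> J(2)[of y] linear_0[OF J(1)] by simp
  ultimately show "a = 0 \<and> b = 0 \<and> c = 0 \<and> d = 0"
    using ind[of a b] ind[of c d] by (simp add: x_def y_def)
qed

lemma leaf_span:
  assumes fr: "frame v\<^sub>1 v\<^sub>2 (J v\<^sub>1) (J v\<^sub>2)" and v: "v\<^sub>1 \<in> V" "v\<^sub>2 \<in> V"
  shows "x \<in> V \<Longrightarrow> \<exists>a b. x = a *\<^sub>R v\<^sub>1 + b *\<^sub>R v\<^sub>2"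
    and "x \<in> W \<Longrightarrow> \<exists>a b. x = a *\<^sub>R J v\<^sub>1 + b *\<^sub>R J v\<^sub>2"
proof -
  obtain a b c d where x: "x = a *\<^sub>R v\<^sub>1 + b *\<^sub>R v\<^sub>2 + c *\<^sub>R J v\<^sub>1 + d *\<^sub>R J v\<^sub>2"
    using frame_span[OF fr dim] by metis
  define p q where "p = a *\<^sub>R v\<^sub>1 + b *\<^sub>R v\<^sub>2" and "q = c *\<^sub>R J v\<^sub>1 + d *\<^sub>R J v\<^sub>2"
  have p: "p \<in> V" using v V(1) by (simp add: p_def subspace_add subspace_scale)
  have q: "q \<in> W" using v JV W(1) by (simp add: q_def subspace_add subspace_scale)
  have xpq: "x = p + q" by (simp add: x p_def q_def add.assoc)
  show "\<exists>a b. x = a *\<^sub>R v\<^sub>1 + b *\<^sub>R v\<^sub>2" if "x \<in> V"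
  proof -
    have "q \<in> V" using subspace_diff[OF V(1) that p] xpq by simp
    then have "q = 0" using q V_Int_W by blast
    with xpq p_def show ?thesis by auto
  qed
  show "\<exists>a b. x = a *\<^sub>R J v\<^sub>1 + b *\<^sub>R J v\<^sub>2" if "x \<in> W"
  proof -
    have "p \<in> W" using subspace_diff[OF W(1) that q] xpq by simp
    then have "p = 0" using p V_Int_W by blast
    with xpq q_def show ?thesis by auto
  qed
qed

text \<open>\<open>J\<close> maps \<open>V\<close> isomorphically onto the complement \<open>W\<close>.\<close>

lemma dim_leaf: "dim V = 2"
proof -
  have "inj J" by (rule injI) (metis J(2) minus_equation_iff)
  then have "dim W = dim V"
    using dim_image_eq[OF J(1), of V] V_eq by (simp add: inj_on_subset)
  moreover have "dim {x + y |x y. x \<in> V \<and> y \<in> W} + dim (V \<inter> W) = dim V + dim W"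
    by (rule dim_sums_Int[OF V(1) W(1)])
  moreover have "{x + y |x y. x \<in> V \<and> y \<in> W} = UNIV" using decompose by blast
  ultimately show ?thesis using dim V_Int_W by simp
qed

lemma leaf_complement:
  assumes "v \<in> V" 
  obtains u where "u \<in> V" "\<And>a. u \<noteq> a *\<^sub>R v"
proof -
  have "\<not> V \<subseteq> span {v}"
  proof
    assume "V \<subseteq> span {v}"
    then have "dim V \<le> card {v}" by (rule dim_le_card) simp
    then show False by (simp add: dim_leaf)
  qed
  then show ?thesis using that span_base span_scale by (metis insertI1 subsetI)
qed

lemma orthogonal_leaf_basis:
  assumes v: "v\<^sub>2 \<in> V" "h v\<^sub>2 v\<^sub>2 \<noteq> 0"
  obtains v\<^sub>1 where "v\<^sub>1 \<in> V" "h v\<^sub>1 v\<^sub>2 = 0" "h v\<^sub>1 v\<^sub>1 \<noteq> 0" "frame v\<^sub>1 v\<^sub>2 (J v\<^sub>1) (J v\<^sub>2)"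
proof -
  note hl = bilinear_expand[OF h(1)]
  obtain u where u: "u \<in> V" "\<And>a. u \<noteq> a *\<^sub>R v\<^sub>2" using leaf_complement[OF v(1)] by blast
  define v\<^sub>1 where "v\<^sub>1 = u - (h u v\<^sub>2 / h v\<^sub>2 v\<^sub>2) *\<^sub>R v\<^sub>2"
  have v1: "v\<^sub>1 \<in> V" using u v V(1) by (simp add: v\<^sub>1_def subspace_diff subspace_scale)
  have orth: "h v\<^sub>1 v\<^sub>2 = 0" using v(2) by (simp add: v\<^sub>1_def hl)
  have nz: "v\<^sub>1 \<noteq> 0" using u(2) by (simp add: v\<^sub>1_def)
  have "a = 0 \<and> b = 0" if *: "a *\<^sub>R v\<^sub>1 + b *\<^sub>R v\<^sub>2 = 0" for a b
  proof -
    have "h (a *\<^sub>R v\<^sub>1 + b *\<^sub>R v\<^sub>2) v\<^sub>2 = 0" by (simp only: *) (simp add: hl)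
    then have "b = 0" using v(2) by (simp add: hl orth)
    with * nz show ?thesis by simp
  qed
  then have fr: "frame v\<^sub>1 v\<^sub>2 (J v\<^sub>1) (J v\<^sub>2)" by (rule leaf_frame[OF v1 v(1)])
  have "h v\<^sub>1 v\<^sub>1 \<noteq> 0"
  proof
    assume 0: "h v\<^sub>1 v\<^sub>1 = 0"
    obtain x where x: "x \<in> V" "h v\<^sub>1 x \<noteq> 0" using nondegenerate_on_leaf[OF v1 nz] by blast
    obtain a b where "x = a *\<^sub>R v\<^sub>1 + b *\<^sub>R v\<^sub>2" using leaf_span(1)[OF fr v1 v(1) x(1)] by blast
    with x(2) 0 orth show False by (simp add: hl)
  qed
  with that v1 orth fr show ?thesis by blast
qed

lemma isotropic_leaf_basis:
  assumes v: "v\<^sub>2 \<in> V" "v\<^sub>2 \<noteq> 0" "h v\<^sub>2 v\<^sub>2 = 0"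
  obtains v\<^sub>1 where "v\<^sub>1 \<in> V" "h v\<^sub>1 v\<^sub>2 \<noteq> 0" "h v\<^sub>1 v\<^sub>1 = 0" "frame v\<^sub>1 v\<^sub>2 (J v\<^sub>1) (J v\<^sub>2)"
proof -
  note hl = bilinear_expand[OF h(1)]
  obtain u where u: "u \<in> V" "h v\<^sub>2 u \<noteq> 0" using nondegenerate_on_leaf[OF v(1,2)] by blast
  then have uv: "h u v\<^sub>2 \<noteq> 0" by (simp add: h(2)[of u v\<^sub>2])
  \<comment> \<open>On the line \<open>u + \<real> v\<^sub>2\<close> the quadratic form of \<open>h\<close> is affine, with exactly one zero.\<close>
  define v\<^sub>1 where "v\<^sub>1 = u - (h u u / (2 * h u v\<^sub>2)) *\<^sub>R v\<^sub>2"
  have v1: "v\<^sub>1 \<in> V" using u v V(1) by (simp add: v\<^sub>1_def subspace_diff subspace_scale)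
  have 12: "h v\<^sub>1 v\<^sub>2 = h u v\<^sub>2" using v(3) by (simp add: v\<^sub>1_def hl)
  have 11: "h v\<^sub>1 v\<^sub>1 = 0" using v(3) uv by (simp add: v\<^sub>1_def hl h(2)[of v\<^sub>2 u])
  have "a = 0 \<and> b = 0" if *: "a *\<^sub>R v\<^sub>1 + b *\<^sub>R v\<^sub>2 = 0" for a b
  proof -
    have "h (a *\<^sub>R v\<^sub>1 + b *\<^sub>R v\<^sub>2) v\<^sub>2 = 0" by (simp only: *) (simp add: hl)
    then have "a = 0" using v(3) uv by (simp add: hl 12)
    with * v(2) show ?thesis by simp
  qed
  then have "frame v\<^sub>1 v\<^sub>2 (J v\<^sub>1) (J v\<^sub>2)" by (rule leaf_frame[OF v1 v(1)])
  with that v1 11 12 uv show ?thesis by auto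
qed

lemma ex_anisotropic: obtains v where "v \<in> V" "h v v \<noteq> 0"
proof -
  note hl = bilinear_expand[OF h(1)]
  obtain x where x: "x \<in> V" "\<And>a. x \<noteq> a *\<^sub>R 0"
    using leaf_complement[OF subspace_0[OF V(1)]] by blast
  then have "x \<noteq> 0" by simp
  then obtain y where y: "y \<in> V" "h x y \<noteq> 0" using nondegenerate_on_leaf[OF x(1)] by blast
  have "h (x + y) (x + y) = h x x + h y y + 2 * h x y" by (simp add: hl h(2)[of y x])
  with y x(1) V(1) that show ?thesis by (metis add_0 mult_eq_0_iff subspace_add zero_neq_numeral)
qed

text \<open>All linear conditions on the bracket, expressed in a frame \<open>(v\<^sub>1, v\<^sub>2, J v\<^sub>1, J v\<^sub>2)\<close> whose
  Gram matrix on \<open>V\<close> has the entries \<open>E\<close>, \<open>F\<close>, \<open>G\<close>.  Four equations say that the leaves are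
  subalgebras, four come from the Nijenhuis tensor at \<open>(v\<^sub>1, v\<^sub>2)\<close>, which determines the whole
  tensor since \<open>N\<^sub>J(Jx,y) = - J N\<^sub>J(x,y)\<close>, and four from \<open>d\<omega>\<close> at the triples of frame vectors.\<close>

lemma frame_equations:
  assumes fr: "frame v\<^sub>1 v\<^sub>2 (J v\<^sub>1) (J v\<^sub>2)" and v: "v\<^sub>1 \<in> V" "v\<^sub>2 \<in> V"
  defines "E \<equiv> h v\<^sub>1 v\<^sub>1" and "F \<equiv> h v\<^sub>1 v\<^sub>2" and "G \<equiv> h v\<^sub>2 v\<^sub>2"
    and "\<phi> \<equiv> comb v\<^sub>1 v\<^sub>2 (J v\<^sub>1) (J v\<^sub>2)"
  obtains a b c d e f where "br v\<^sub>1 v\<^sub>2 = \<phi> a" "br v\<^sub>1 (J v\<^sub>1) = \<phi> b" "br v\<^sub>1 (J v\<^sub>2) = \<phi> c"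
    "br v\<^sub>2 (J v\<^sub>1) = \<phi> d" "br v\<^sub>2 (J v\<^sub>2) = \<phi> e" "br (J v\<^sub>1) (J v\<^sub>2) = \<phi> f"
    and "a$3 = 0" "a$4 = 0" "f$1 = 0" "f$2 = 0"
    and "f$3 + d$1 = c$1" "f$4 + d$2 = c$2" "d$3 + a$1 = c$3" "d$4 + a$2 = c$4"
    and "d$3 * E + d$4 * F = a$1 * E + a$2 * F + b$3 * F + b$4 * G"
    and "e$3 * E + e$4 * F = a$1 * F + a$2 * G + c$3 * F + c$4 * G"
    and "b$1 * F + b$2 * G = c$1 * E + c$2 * F + f$3 * E + f$4 * F"
    and "d$1 * F + d$2 * G = e$1 * E + e$2 * F + f$3 * F + f$4 * G"
proof -
  note hl = bilinear_expand[OF h(1)]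
  have "surj \<phi>" using bij_comb[OF fr dim] by (simp add: \<phi>_def bij_def)
  then have coords: "\<exists>y. x = \<phi> y" for x unfolding surj_def by blast
  obtain b c d e where bc: "br v\<^sub>1 (J v\<^sub>1) = \<phi> b" "br v\<^sub>1 (J v\<^sub>2) = \<phi> c"
    "br v\<^sub>2 (J v\<^sub>1) = \<phi> d" "br v\<^sub>2 (J v\<^sub>2) = \<phi> e"
    using coords[of "br v\<^sub>1 (J v\<^sub>1)"] coords[of "br v\<^sub>1 (J v\<^sub>2)"] coords[of "br v\<^sub>2 (J v\<^sub>1)"]
      coords[of "br v\<^sub>2 (J v\<^sub>2)"] by (elim exE) 
  obtain a\<^sub>1 a\<^sub>2 where "br v\<^sub>1 v\<^sub>2 = a\<^sub>1 *\<^sub>R v\<^sub>1 + a\<^sub>2 *\<^sub>R v\<^sub>2"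
    using leaf_span(1)[OF fr v V(2)[OF v]] by blast
  define a :: "real^4" where "a = vector [a\<^sub>1, a\<^sub>2, 0, 0]"
  have a: "br v\<^sub>1 v\<^sub>2 = \<phi> a" "a$3 = 0" "a$4 = 0"
    using \<open>br v\<^sub>1 v\<^sub>2 = _\<close> by (simp_all add: \<phi>_def comb_def a_def)
  obtain f\<^sub>1 f\<^sub>2 where "br (J v\<^sub>1) (J v\<^sub>2) = f\<^sub>1 *\<^sub>R J v\<^sub>1 + f\<^sub>2 *\<^sub>R J v\<^sub>2"
    using leaf_span(2)[OF fr v W(2)[OF JV[OF v(1)] JV[OF v(2)]]] by blast
  define f :: "real^4" where "f = vector [0, 0, f\<^sub>1, f\<^sub>2]"
  have f: "br (J v\<^sub>1) (J v\<^sub>2) = \<phi> f" "f$1 = 0" "f$2 = 0"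
    using \<open>br (J v\<^sub>1) (J v\<^sub>2) = _\<close> by (simp_all add: \<phi>_def comb_def f_def)
  note Jl = linear_add[OF J(1)] linear_scale[OF J(1)] linear_diff[OF J(1)] linear_neg[OF J(1)] J(2)
  have Jv: "br (J v\<^sub>1) v\<^sub>2 = - \<phi> d" using bc lie_algebraD(3)[OF br, of "J v\<^sub>1" v\<^sub>2] by simp
  have "nijenhuis br J v\<^sub>1 v\<^sub>2 = (- d$3 + c$3 - a$1) *\<^sub>R v\<^sub>1 + (- d$4 + c$4 - a$2) *\<^sub>R v\<^sub>2
      + (f$3 + d$1 - c$1) *\<^sub>R J v\<^sub>1 + (f$4 + d$2 - c$2) *\<^sub>R J v\<^sub>2"
    unfolding nijenhuis_def Jv bc a(1) f(1)
    by (simp add: \<phi>_def comb_def Jl a f algebra_simps)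
  then have "(- d$3 + c$3 - a$1) *\<^sub>R v\<^sub>1 + (- d$4 + c$4 - a$2) *\<^sub>R v\<^sub>2
      + (f$3 + d$1 - c$1) *\<^sub>R J v\<^sub>1 + (f$4 + d$2 - c$2) *\<^sub>R J v\<^sub>2 = 0"
    by (simp only: nijenhuis)
  from frameD[OF fr this]
  have N: "f$3 + d$1 = c$1" "f$4 + d$2 = c$2" "d$3 + a$1 = c$3" "d$4 + a$2 = c$4" by simp_all
  note orth = orthogonal[OF v(1) JV[OF v(1)]] orthogonal[OF v(1) JV[OF v(2)]]
    orthogonal[OF v(2) JV[OF v(1)]] orthogonal[OF v(2) JV[OF v(2)]]
  have orth': "h (J v\<^sub>1) v\<^sub>1 = 0" "h (J v\<^sub>2) v\<^sub>1 = 0" "h (J v\<^sub>1) v\<^sub>2 = 0" "h (J v\<^sub>2) v\<^sub>2 = 0"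
    using orth by (simp_all add: h(2)[of "J v\<^sub>1"] h(2)[of "J v\<^sub>2"])
  have gram: "h v\<^sub>1 v\<^sub>1 = E" "h v\<^sub>1 v\<^sub>2 = F" "h v\<^sub>2 v\<^sub>1 = F" "h v\<^sub>2 v\<^sub>2 = G"
    by (simp_all add: E_def F_def G_def h(2)[of v\<^sub>2 v\<^sub>1])
  have \<omega>: "h (J (\<phi> x)) v\<^sub>1 = - (x$3 * E + x$4 * F)" "h (J (\<phi> x)) v\<^sub>2 = - (x$3 * F + x$4 * G)"
    "h (J (\<phi> x)) (J v\<^sub>1) = x$1 * E + x$2 * F" "h (J (\<phi> x)) (J v\<^sub>2) = x$1 * F + x$2 * G" for x
    by (simp_all add: \<phi>_def comb_def Jl hl orth orth' J(3) gram)
  have \<omega>1: "d$3 * E + d$4 * F = a$1 * E + a$2 * F + b$3 * F + b$4 * G"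
    using closed[of v\<^sub>1 v\<^sub>2 "J v\<^sub>1"] unfolding ce_differential_def bc a(1) \<omega> by simp
  have \<omega>2: "e$3 * E + e$4 * F = a$1 * F + a$2 * G + c$3 * F + c$4 * G"
    using closed[of v\<^sub>1 v\<^sub>2 "J v\<^sub>2"] unfolding ce_differential_def bc a(1) \<omega> by simp
  have \<omega>3: "b$1 * F + b$2 * G = c$1 * E + c$2 * F + f$3 * E + f$4 * F"
    using closed[of v\<^sub>1 "J v\<^sub>1" "J v\<^sub>2"] unfolding ce_differential_def bc f(1) \<omega> by simp
  have \<omega>4: "d$1 * F + d$2 * G = e$1 * E + e$2 * F + f$3 * F + f$4 * G"
    using closed[of v\<^sub>2 "J v\<^sub>1" "J v\<^sub>2"] unfolding ce_differential_def bc f(1) \<omega> by simp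
  show ?thesis by (rule that[of a b c d e f]) (fact a bc f N \<omega>1 \<omega>2 \<omega>3 \<omega>4)+
qed

text \<open>The twelve parameters are those of the Levi-Civita connection described at the beginning: \<open>\<epsilon>\<close> is
  normalised by \<open>\<epsilon> v\<^sub>1 = v\<^sub>2\<close>, \<open>\<epsilon> v\<^sub>2 = - k v\<^sub>1\<close>, the numbers \<open>\<alpha>\<^sub>i\<close>, \<open>\<beta>\<^sub>i\<close> are the values of \<open>\<alpha>\<close>, \<open>\<beta>\<close>
  on the basis, and \<open>S(v\<^sub>1) v\<^sub>1 = p v\<^sub>1 + q v\<^sub>2\<close>, \<open>S(v\<^sub>1) v\<^sub>2 = k q v\<^sub>1 + r v\<^sub>2\<close>,
  \<open>S(v\<^sub>2) v\<^sub>2 = k r v\<^sub>1 + s v\<^sub>2\<close>, similarly for \<open>T\<close> with capital letters.\<close>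

lemma orthogonal_frame_brackets:
  assumes fr: "frame v\<^sub>1 v\<^sub>2 (J v\<^sub>1) (J v\<^sub>2)" and v: "v\<^sub>1 \<in> V" "v\<^sub>2 \<in> V"
    and orth: "h v\<^sub>1 v\<^sub>2 = 0" and nz: "h v\<^sub>1 v\<^sub>1 \<noteq> 0" "k \<noteq> 0" and k: "h v\<^sub>2 v\<^sub>2 = k * h v\<^sub>1 v\<^sub>1"
  defines "\<phi> \<equiv> comb v\<^sub>1 v\<^sub>2 (J v\<^sub>1) (J v\<^sub>2)"
  obtains \<alpha>\<^sub>1 \<alpha>\<^sub>2 \<beta>\<^sub>1 \<beta>\<^sub>2 p q r s P Q R Z where
    "br v\<^sub>1 v\<^sub>2 = \<phi> (vector [- k * \<alpha>\<^sub>1, - \<alpha>\<^sub>2, 0, 0])"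
    "br v\<^sub>1 (J v\<^sub>1) = \<phi> (vector [- p, - q - \<beta>\<^sub>1, - P, \<alpha>\<^sub>1 - Q])"
    "br v\<^sub>1 (J v\<^sub>2) = \<phi> (vector [- k * q, - r - \<beta>\<^sub>2, - k * (Q + \<alpha>\<^sub>1), - R])"
    "br v\<^sub>2 (J v\<^sub>1) = \<phi> (vector [k * (\<beta>\<^sub>1 - q), - r, - k * Q, \<alpha>\<^sub>2 - R])"
    "br v\<^sub>2 (J v\<^sub>2) = \<phi> (vector [k * (\<beta>\<^sub>2 - r), - s, - k * (R + \<alpha>\<^sub>2), - Z])"
    "br (J v\<^sub>1) (J v\<^sub>2) = \<phi> (vector [0, 0, - k * \<beta>\<^sub>1, - \<beta>\<^sub>2])"
proof -
  define E where "E = h v\<^sub>1 v\<^sub>1"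
  have E: "E \<noteq> 0" and G: "h v\<^sub>2 v\<^sub>2 = k * E" using nz k by (simp_all add: E_def)
  obtain a b c d e f where b: "br v\<^sub>1 v\<^sub>2 = \<phi> a" "br v\<^sub>1 (J v\<^sub>1) = \<phi> b" "br v\<^sub>1 (J v\<^sub>2) = \<phi> c"
      "br v\<^sub>2 (J v\<^sub>1) = \<phi> d" "br v\<^sub>2 (J v\<^sub>2) = \<phi> e" "br (J v\<^sub>1) (J v\<^sub>2) = \<phi> f"
    and z: "a$3 = 0" "a$4 = 0" "f$1 = 0" "f$2 = 0"
    and N: "f$3 + d$1 = c$1" "f$4 + d$2 = c$2" "d$3 + a$1 = c$3" "d$4 + a$2 = c$4"
    and w1: "d$3 * E = a$1 * E + b$4 * (k * E)"
    and w2: "e$3 * E = a$2 * (k * E) + c$4 * (k * E)"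
    and w3: "b$2 * (k * E) = c$1 * E + f$3 * E"
    and w4: "d$2 * (k * E) = e$1 * E + f$4 * (k * E)"
    by (rule frame_equations[OF fr v]) (simp add: orth G \<phi>_def flip: E_def)
  have cancel: "x = y" if "x * E = y * E" for x y using that E by simp
  have w: "d$3 = a$1 + k * b$4" "e$3 = k * (a$2 + c$4)" "c$1 = k * b$2 - f$3" "e$1 = k * (d$2 - f$4)"
    by (rule cancel, use w1 w2 w3 w4 in \<open>simp add: algebra_simps\<close>)+
  let ?\<alpha>\<^sub>1 = "- a$1 / k" and ?\<alpha>\<^sub>2 = "- a$2" and ?\<beta>\<^sub>1 = "- f$3 / k" and ?\<beta>\<^sub>2 = "- f$4"
  let ?q = "- b$2 - ?\<beta>\<^sub>1" and ?Q = "?\<alpha>\<^sub>1 - b$4"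
  have 1: "a = vector [- k * ?\<alpha>\<^sub>1, - ?\<alpha>\<^sub>2, 0, 0]"
    using z nz by (simp add: vec_eq_iff forall_4)
  have 2: "b = vector [- (- b$1), - ?q - ?\<beta>\<^sub>1, - (- b$3), ?\<alpha>\<^sub>1 - ?Q]"
    by (simp add: vec_eq_iff forall_4)
  have 3: "c = vector [- k * ?q, - (- d$2) - ?\<beta>\<^sub>2, - k * (?Q + ?\<alpha>\<^sub>1), - (- c$4)]"
    using nz N w by (simp add: vec_eq_iff forall_4 algebra_simps)
  have 4: "d = vector [k * (?\<beta>\<^sub>1 - ?q), - (- d$2), - k * ?Q, ?\<alpha>\<^sub>2 - (- c$4)]"
    using nz N w by (simp add: vec_eq_iff forall_4 algebra_simps)
  have 5: "e = vector [k * (?\<beta>\<^sub>2 - (- d$2)), - (- e$2), - k * (- c$4 + ?\<alpha>\<^sub>2), - (- e$4)]"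
    using nz N w by (simp add: vec_eq_iff forall_4 algebra_simps)
  have 6: "f = vector [0, 0, - k * ?\<beta>\<^sub>1, - ?\<beta>\<^sub>2]"
    using z nz by (simp add: vec_eq_iff forall_4)
  show ?thesis
    by (rule that[of ?\<alpha>\<^sub>1 ?\<alpha>\<^sub>2 "- b$1" ?q ?\<beta>\<^sub>1 "- b$3" ?Q "- d$2" ?\<beta>\<^sub>2 "- c$4" "- e$2" "- e$4"])
      (simp_all only: b flip: 1 2 3 4 5 6)
qed

text \<open>The same parameters in an isotropic basis, where \<open>\<epsilon> = diag(1,-1)\<close> and
  \<open>S(v\<^sub>1) v\<^sub>1 = q v\<^sub>1 + p v\<^sub>2\<close>, \<open>S(v\<^sub>1) v\<^sub>2 = r v\<^sub>1 + q v\<^sub>2\<close>, \<open>S(v\<^sub>2) v\<^sub>2 = s v\<^sub>1 + r v\<^sub>2\<close>.\<close>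

lemma isotropic_frame_brackets:
  assumes fr: "frame v\<^sub>1 v\<^sub>2 (J v\<^sub>1) (J v\<^sub>2)" and v: "v\<^sub>1 \<in> V" "v\<^sub>2 \<in> V"
    and iso: "h v\<^sub>1 v\<^sub>1 = 0" "h v\<^sub>2 v\<^sub>2 = 0" and nz: "h v\<^sub>1 v\<^sub>2 \<noteq> 0"
  defines "\<phi> \<equiv> comb v\<^sub>1 v\<^sub>2 (J v\<^sub>1) (J v\<^sub>2)"
  obtains \<alpha>\<^sub>1 \<alpha>\<^sub>2 \<beta>\<^sub>1 \<beta>\<^sub>2 p q r s P Q R Z where
    "br v\<^sub>1 v\<^sub>2 = \<phi> (vector [- \<alpha>\<^sub>2, - \<alpha>\<^sub>1, 0, 0])"
    "br v\<^sub>1 (J v\<^sub>1) = \<phi> (vector [- q - \<beta>\<^sub>1, - p, \<alpha>\<^sub>1 - Q, - P])"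
    "br v\<^sub>1 (J v\<^sub>2) = \<phi> (vector [- r - \<beta>\<^sub>2, - q, - R, - Q - \<alpha>\<^sub>1])"
    "br v\<^sub>2 (J v\<^sub>1) = \<phi> (vector [- r, \<beta>\<^sub>1 - q, \<alpha>\<^sub>2 - R, - Q])"
    "br v\<^sub>2 (J v\<^sub>2) = \<phi> (vector [- s, \<beta>\<^sub>2 - r, - Z, - R - \<alpha>\<^sub>2])"
    "br (J v\<^sub>1) (J v\<^sub>2) = \<phi> (vector [0, 0, - \<beta>\<^sub>2, - \<beta>\<^sub>1])"
proof -
  define F where "F = h v\<^sub>1 v\<^sub>2"
  have F: "F \<noteq> 0" using nz by (simp add: F_def)
  obtain a b c d e f where b: "br v\<^sub>1 v\<^sub>2 = \<phi> a" "br v\<^sub>1 (J v\<^sub>1) = \<phi> b" "br v\<^sub>1 (J v\<^sub>2) = \<phi> c"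
      "br v\<^sub>2 (J v\<^sub>1) = \<phi> d" "br v\<^sub>2 (J v\<^sub>2) = \<phi> e" "br (J v\<^sub>1) (J v\<^sub>2) = \<phi> f"
    and z: "a$3 = 0" "a$4 = 0" "f$1 = 0" "f$2 = 0"
    and N: "f$3 + d$1 = c$1" "f$4 + d$2 = c$2" "d$3 + a$1 = c$3" "d$4 + a$2 = c$4"
    and w1: "d$4 * F = a$2 * F + b$3 * F"
    and w2: "e$4 * F = a$1 * F + c$3 * F"
    and w3: "b$1 * F = c$2 * F + f$4 * F"
    and w4: "d$1 * F = e$2 * F + f$3 * F"
    by (rule frame_equations[OF fr v]) (simp add: iso \<phi>_def flip: F_def)
  have cancel: "x = y" if "x * F = y * F" for x y using that F by simp
  have w: "d$4 = a$2 + b$3" "e$4 = a$1 + c$3" "b$1 = c$2 + f$4" "d$1 = e$2 + f$3"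
    by (rule cancel, use w1 w2 w3 w4 in \<open>simp add: algebra_simps\<close>)+
  let ?\<alpha>\<^sub>1 = "- a$2" and ?\<alpha>\<^sub>2 = "- a$1" and ?\<beta>\<^sub>1 = "- f$4" and ?\<beta>\<^sub>2 = "- f$3"
  have 1: "a = vector [- ?\<alpha>\<^sub>2, - ?\<alpha>\<^sub>1, 0, 0]"
    using z by (simp add: vec_eq_iff forall_4)
  have 2: "b = vector [- (- c$2) - ?\<beta>\<^sub>1, - (- b$2), ?\<alpha>\<^sub>1 - (- d$4), - (- b$4)]"
    using w by (simp add: vec_eq_iff forall_4)
  have 3: "c = vector [- (- d$1) - ?\<beta>\<^sub>2, - (- c$2), - (- c$3), - (- d$4) - ?\<alpha>\<^sub>1]"
    using N by (simp add: vec_eq_iff forall_4)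
  have 4: "d = vector [- (- d$1), ?\<beta>\<^sub>1 - (- c$2), ?\<alpha>\<^sub>2 - (- c$3), - (- d$4)]"
    using N w by (simp add: vec_eq_iff forall_4)
  have 5: "e = vector [- (- e$1), ?\<beta>\<^sub>2 - (- d$1), - (- e$3), - (- c$3) - ?\<alpha>\<^sub>2]"
    using N w by (simp add: vec_eq_iff forall_4)
  have 6: "f = vector [0, 0, - ?\<beta>\<^sub>2, - ?\<beta>\<^sub>1]"
    using z by (simp add: vec_eq_iff forall_4)
  show ?thesis
    by (rule that[of ?\<alpha>\<^sub>2 ?\<alpha>\<^sub>1 "- c$2" ?\<beta>\<^sub>1 "- b$2" "- d$4" "- b$4" "- d$1" ?\<beta>\<^sub>2 "- c$3" "- e$1" "- e$3"])
      (simp_all only: b flip: 1 2 3 4 5 6)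
qed

end

section \<open>Solving the Jacobi equations\<close>

context born_lie_algebra
begin

text \<open>With \<open>\<alpha> = \<beta> = 0\<close> the Jacobi equations \<open>par\<close> say that the trace-free parts of \<open>S(v\<^sub>1)\<close>,
  \<open>S(v\<^sub>2)\<close>, \<open>T(v\<^sub>1)\<close>, \<open>T(v\<^sub>2)\<close>, recorded by the pairs \<open>(q, p - r)\<close>, \<open>(r, k q - s)\<close>, \<open>(Q, P - R)\<close>,
  \<open>(R, k Q - Z)\<close>, are pairwise proportional, that is, the four operators commute.  Either all are
  diagonal, which is the algebra \<open>K\<close> with \<open>M = diag(1,-1)\<close> and cyclic vector \<open>v\<^sub>1 + v\<^sub>2\<close>, or they
  lie in the span of the identity and a matrix \<open>M\<close> with \<open>M v\<^sub>1 = d v\<^sub>1 + v\<^sub>2\<close>,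
  \<open>M v\<^sub>2 = k v\<^sub>1 - d v\<^sub>2\<close>, for which \<open>v\<^sub>1\<close> is cyclic and \<open>M\<^sup>2 = d\<^sup>2 + k\<close>.\<close>

lemma abelian_leaves_cases:
  assumes nonab: "\<not> abelian_lie br"
    and abV: "\<And>x y. x \<in> V \<Longrightarrow> y \<in> V \<Longrightarrow> br x y = 0"
    and abW: "\<And>x y. x \<in> W \<Longrightarrow> y \<in> W \<Longrightarrow> br x y = 0"
  shows "lie_isomorphic br rh3 \<or> lie_isomorphic br rr30 \<or> lie_isomorphic br r2r2 \<or>
    lie_isomorphic br r2' \<or> lie_isomorphic br d41"
proof -
  obtain v\<^sub>2 where v2: "v\<^sub>2 \<in> V" "h v\<^sub>2 v\<^sub>2 \<noteq> 0" using ex_anisotropic by blast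
  obtain v\<^sub>1 where v1: "v\<^sub>1 \<in> V" "h v\<^sub>1 v\<^sub>2 = 0" "h v\<^sub>1 v\<^sub>1 \<noteq> 0"
    and fr: "frame v\<^sub>1 v\<^sub>2 (J v\<^sub>1) (J v\<^sub>2)" using orthogonal_leaf_basis[OF v2] by blast
  define k where "k = h v\<^sub>2 v\<^sub>2 / h v\<^sub>1 v\<^sub>1"
  have k: "k \<noteq> 0" "h v\<^sub>2 v\<^sub>2 = k * h v\<^sub>1 v\<^sub>1" using v1 v2 by (simp_all add: k_def)
  define \<phi> where "\<phi> = comb v\<^sub>1 v\<^sub>2 (J v\<^sub>1) (J v\<^sub>2)"
  obtain \<alpha>\<^sub>1 \<alpha>\<^sub>2 \<beta>\<^sub>1 \<beta>\<^sub>2 p q r s P Q R Z where b: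
    "br v\<^sub>1 v\<^sub>2 = \<phi> (vector [- k * \<alpha>\<^sub>1, - \<alpha>\<^sub>2, 0, 0])"
    "br v\<^sub>1 (J v\<^sub>1) = \<phi> (vector [- p, - q - \<beta>\<^sub>1, - P, \<alpha>\<^sub>1 - Q])"
    "br v\<^sub>1 (J v\<^sub>2) = \<phi> (vector [- k * q, - r - \<beta>\<^sub>2, - k * (Q + \<alpha>\<^sub>1), - R])"
    "br v\<^sub>2 (J v\<^sub>1) = \<phi> (vector [k * (\<beta>\<^sub>1 - q), - r, - k * Q, \<alpha>\<^sub>2 - R])"
    "br v\<^sub>2 (J v\<^sub>2) = \<phi> (vector [k * (\<beta>\<^sub>2 - r), - s, - k * (R + \<alpha>\<^sub>2), - Z])"
    "br (J v\<^sub>1) (J v\<^sub>2) = \<phi> (vector [0, 0, - k * \<beta>\<^sub>1, - \<beta>\<^sub>2])"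
    by (rule orthogonal_frame_brackets[OF fr v1(1) v2(1) v1(2,3) k, folded \<phi>_def]) blast
  have "br v\<^sub>1 v\<^sub>2 = 0" using abV v1 v2 by blast
  from frameD(1,2)[OF fr this[unfolded b(1) \<phi>_def comb_def]] k(1) have \<alpha>: "\<alpha>\<^sub>1 = 0" "\<alpha>\<^sub>2 = 0"
    by simp_all
  have "br (J v\<^sub>1) (J v\<^sub>2) = 0" using abW JV v1 v2 by blast
  from frameD(3,4)[OF fr this[unfolded b(6) \<phi>_def comb_def]] k(1) have \<beta>: "\<beta>\<^sub>1 = 0" "\<beta>\<^sub>2 = 0"
    by simp_all
  note jac = jacobi_coordinates[OF br fr b[unfolded \<alpha> \<beta> \<phi>_def]]
  have scaled: "k * (Q * (p - r)) = k * (q * (P - R))" "k * (R * (p - r)) = k * (q * (k * Q - Z))"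
    using arg_cong[OF jac(1), of "\<lambda>x. x$1"] arg_cong[OF jac(2), of "\<lambda>x. x$1"]
    by (simp_all add: algebra_simps)
  have scaled': "Q * (p - r) = q * (P - R)" "R * (p - r) = q * (k * Q - Z)"
    using scaled k(1) by (simp_all only: mult_cancel_left) simp_all
  have par: "Q * (p - r) = q * (P - R)" "Q * (k * q - s) = r * (P - R)" "R * (P - R) = Q * (k * Q - Z)"
    "R * (p - r) = q * (k * Q - Z)" "R * (k * q - s) = r * (k * Q - Z)" "r * (p - r) = q * (k * q - s)"
    using scaled' k(1) arg_cong[OF jac(1), of "\<lambda>x. x$2"] arg_cong[OF jac(1), of "\<lambda>x. x$4"]
      arg_cong[OF jac(2), of "\<lambda>x. x$2"] arg_cong[OF jac(3), of "\<lambda>x. x$2"]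
    by (simp_all add: algebra_simps)
  note bl = bilinear_expand[OF lie_algebraD(1)[OF br]] lie_algebraD(2)[OF br]
  note B = b[unfolded \<alpha> \<beta> \<phi>_def comb_def, simplified]
  note B = B(1-6) lie_algebraD(3)[OF br, of v\<^sub>2 v\<^sub>1] lie_algebraD(3)[OF br, of "J v\<^sub>2" "J v\<^sub>1"]
  show ?thesis
  proof (cases "q = 0 \<and> r = 0 \<and> Q = 0 \<and> R = 0")
    case True
    have "frame (v\<^sub>1 + v\<^sub>2) (v\<^sub>1 - v\<^sub>2) (J v\<^sub>1 + J v\<^sub>2) (J v\<^sub>1 - J v\<^sub>2)"
    proof (rule frameI)
      fix a b c d
      assume "a *\<^sub>R (v\<^sub>1 + v\<^sub>2) + b *\<^sub>R (v\<^sub>1 - v\<^sub>2) + c *\<^sub>R (J v\<^sub>1 + J v\<^sub>2) + d *\<^sub>R (J v\<^sub>1 - J v\<^sub>2) = 0"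
      then have "(a + b) *\<^sub>R v\<^sub>1 + (a - b) *\<^sub>R v\<^sub>2 + (c + d) *\<^sub>R J v\<^sub>1 + (c - d) *\<^sub>R J v\<^sub>2 = 0"
        by (simp add: algebra_simps)
      from frameD[OF fr this] show "a = 0 \<and> b = 0 \<and> c = 0 \<and> d = 0" by simp
    qed
    note fr' = this
    define \<sigma>\<^sub>0 \<sigma>\<^sub>1 \<tau>\<^sub>0 \<tau>\<^sub>1 where "\<sigma>\<^sub>0 = (p + s) / 2" and "\<sigma>\<^sub>1 = (p - s) / 2"
      and "\<tau>\<^sub>0 = (P + Z) / 2" and "\<tau>\<^sub>1 = (P - Z) / 2"
    then have diag: "p = \<sigma>\<^sub>0 + \<sigma>\<^sub>1" "s = \<sigma>\<^sub>0 - \<sigma>\<^sub>1" "P = \<tau>\<^sub>0 + \<tau>\<^sub>1" "Z = \<tau>\<^sub>0 - \<tau>\<^sub>1"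
      by (simp_all add: field_simps)
    show ?thesis
      by (rule planar_algebra_cases[OF br dim nonab fr' refl refl,
            where c = 1 and s\<^sub>0 = \<sigma>\<^sub>0 and s\<^sub>1 = \<sigma>\<^sub>1 and t\<^sub>0 = \<tau>\<^sub>0 and t\<^sub>1 = \<tau>\<^sub>1])
        (simp_all add: bl B True diag algebra_simps)
  next
    case False
    have "\<exists>d. p - r = 2 * d * q \<and> k * q - s = 2 * d * r \<and> P - R = 2 * d * Q \<and> k * Q - Z = 2 * d * R"
    proof -
      consider "q \<noteq> 0" | "r \<noteq> 0" | "Q \<noteq> 0" | "R \<noteq> 0" using False by blast
      then show ?thesis
      proof cases
        case 1 then show ?thesis by (intro exI[of _ "(p - r) / (2 * q)"]) (use par in \<open>simp add: field_simps\<close>)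
      next
        case 2 then show ?thesis by (intro exI[of _ "(k * q - s) / (2 * r)"]) (use par in \<open>simp add: field_simps\<close>)
      next
        case 3 then show ?thesis by (intro exI[of _ "(P - R) / (2 * Q)"]) (use par in \<open>simp add: field_simps\<close>)
      next
        case 4 then show ?thesis by (intro exI[of _ "(k * Q - Z) / (2 * R)"]) (use par in \<open>simp add: field_simps\<close>)
      qed
    qed
    then obtain d where "p - r = 2 * d * q" "k * q - s = 2 * d * r" "P - R = 2 * d * Q" "k * Q - Z = 2 * d * R"
      by blast
    then have d: "p = r + 2 * d * q" "s = k * q - 2 * d * r" "P = R + 2 * d * Q" "Z = k * Q - 2 * d * R"
      by linarith+
    have "frame v\<^sub>1 (v\<^sub>2 + d *\<^sub>R v\<^sub>1) (J v\<^sub>1) (J v\<^sub>2 + d *\<^sub>R J v\<^sub>1)"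
    proof (rule frameI)
      fix x y z w
      assume "x *\<^sub>R v\<^sub>1 + y *\<^sub>R (v\<^sub>2 + d *\<^sub>R v\<^sub>1) + z *\<^sub>R J v\<^sub>1 + w *\<^sub>R (J v\<^sub>2 + d *\<^sub>R J v\<^sub>1) = 0"
      then have "(x + y * d) *\<^sub>R v\<^sub>1 + y *\<^sub>R v\<^sub>2 + (z + w * d) *\<^sub>R J v\<^sub>1 + w *\<^sub>R J v\<^sub>2 = 0"
        by (simp add: algebra_simps)
      from frameD[OF fr this] show "x = 0 \<and> y = 0 \<and> z = 0 \<and> w = 0" by simp
    qed
    note fr' = this
    show ?thesis
      by (rule planar_algebra_cases[OF br dim nonab fr' refl refl, where c = "d * d + k"
            and s\<^sub>0 = "r + d * q" and s\<^sub>1 = q and t\<^sub>0 = "R + d * Q" and t\<^sub>1 = Q])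
        (simp_all add: bl B d scaleR_twice algebra_simps)
  qed
qed

text \<open>The leaf equation \<open>[v\<^sub>1,v\<^sub>2] = l v\<^sub>2\<close> means \<open>\<alpha>\<^sub>1 = 0\<close> and \<open>\<alpha>\<^sub>2 = - l = a\<close>.  The equations for the
  triples containing \<open>v\<^sub>1\<close> and \<open>v\<^sub>2\<close> determine \<open>T\<close> up to a sign, \<open>Q = Z = 0\<close>, \<open>P = 2 R\<close>, \<open>R = \<plusminus> a\<close>,
  and the others leave one free parameter \<open>r\<close>: \<open>S\<close> is proportional to \<open>T\<close> and \<open>\<beta>\<^sub>2 = - r R / a\<close>.
  In both solutions \<open>v\<^sub>1 / a\<close> acts on the nilradical, a Heisenberg algebra, with the weights
  \<open>-1, -1, -2\<close> for \<open>R = a\<close> and \<open>-1, 2, 1\<close> for \<open>R = - a\<close>.\<close>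

lemma orthogonal_leaf_cases:
  assumes fr: "frame v\<^sub>1 v\<^sub>2 (J v\<^sub>1) (J v\<^sub>2)" and v: "v\<^sub>1 \<in> V" "v\<^sub>2 \<in> V"
    and orth: "h v\<^sub>1 v\<^sub>2 = 0" and nz: "h v\<^sub>1 v\<^sub>1 \<noteq> 0" "h v\<^sub>2 v\<^sub>2 \<noteq> 0"
    and l: "br v\<^sub>1 v\<^sub>2 = l *\<^sub>R v\<^sub>2" "l \<noteq> 0"
  shows "lie_isomorphic br d42 \<or> lie_isomorphic br d4half"
proof -
  define k where "k = h v\<^sub>2 v\<^sub>2 / h v\<^sub>1 v\<^sub>1"
  have k: "k \<noteq> 0" "h v\<^sub>2 v\<^sub>2 = k * h v\<^sub>1 v\<^sub>1" using nz by (simp_all add: k_def)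
  define \<phi> where "\<phi> = comb v\<^sub>1 v\<^sub>2 (J v\<^sub>1) (J v\<^sub>2)"
  obtain \<alpha>\<^sub>1 \<alpha>\<^sub>2 \<beta>\<^sub>1 \<beta>\<^sub>2 p q r s P Q R Z where b:
    "br v\<^sub>1 v\<^sub>2 = \<phi> (vector [- k * \<alpha>\<^sub>1, - \<alpha>\<^sub>2, 0, 0])"
    "br v\<^sub>1 (J v\<^sub>1) = \<phi> (vector [- p, - q - \<beta>\<^sub>1, - P, \<alpha>\<^sub>1 - Q])"
    "br v\<^sub>1 (J v\<^sub>2) = \<phi> (vector [- k * q, - r - \<beta>\<^sub>2, - k * (Q + \<alpha>\<^sub>1), - R])"
    "br v\<^sub>2 (J v\<^sub>1) = \<phi> (vector [k * (\<beta>\<^sub>1 - q), - r, - k * Q, \<alpha>\<^sub>2 - R])"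
    "br v\<^sub>2 (J v\<^sub>2) = \<phi> (vector [k * (\<beta>\<^sub>2 - r), - s, - k * (R + \<alpha>\<^sub>2), - Z])"
    "br (J v\<^sub>1) (J v\<^sub>2) = \<phi> (vector [0, 0, - k * \<beta>\<^sub>1, - \<beta>\<^sub>2])"
    by (rule orthogonal_frame_brackets[OF fr v orth nz(1) k, folded \<phi>_def]) blast
  have "(- k * \<alpha>\<^sub>1) *\<^sub>R v\<^sub>1 + (- \<alpha>\<^sub>2 - l) *\<^sub>R v\<^sub>2 + 0 *\<^sub>R J v\<^sub>1 + 0 *\<^sub>R J v\<^sub>2 = 0"
    using b(1) l(1) by (simp add: \<phi>_def comb_def algebra_simps)
  from frameD(1,2)[OF fr this] k(1) have \<alpha>: "\<alpha>\<^sub>1 = 0" "\<alpha>\<^sub>2 = - l" by simp_all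
  note jac = jacobi_coordinates[OF br fr b[unfolded \<alpha> \<phi>_def]]
  define a where "a = - l"
  note jac = jac[folded a_def]
  have a: "a \<noteq> 0" using l(2) by (simp add: a_def)
  note J\<^sub>1 = arg_cong[OF jac(1), of "\<lambda>x. x$_"] and J\<^sub>2 = arg_cong[OF jac(2), of "\<lambda>x. x$_"]
    and J\<^sub>3 = arg_cong[OF jac(3), of "\<lambda>x. x$_"] and J\<^sub>4 = arg_cong[OF jac(4), of "\<lambda>x. x$_"]
  have "k * (3 * a * Q) = 0" using J\<^sub>1[of 3] by (simp add: algebra_simps)
  then have Q: "Q = 0" using a k(1) by simp
  have "a * Z = 0" using J\<^sub>2[of 4] Q by (simp add: algebra_simps)
  then have Z: "Z = 0" using a by simp
  have 1: "a\<^sup>2 + a * P - 2 * a * R - P * R + R\<^sup>2 = 0"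
    using J\<^sub>1[of 4] by (simp add: Q Z algebra_simps power2_eq_square)
  have "k * (- a\<^sup>2 + a * P - 2 * a * R + P * R - R\<^sup>2) = 0"
    using J\<^sub>2[of 3] by (simp add: Q Z algebra_simps power2_eq_square)
  then have 2: "- a\<^sup>2 + a * P - 2 * a * R + P * R - R\<^sup>2 = 0" using k(1) by simp
  have "a * P = 2 * a * R" using 1 2 by linarith
  then have P: "P = 2 * R" using a by simp
  have "R\<^sup>2 = a\<^sup>2" using 1 by (simp add: P power2_eq_square)
  then have R: "R = a \<or> R = - a" by (simp add: power2_eq_iff)
  have "k * (a * \<beta>\<^sub>1 - 2 * a * q + 2 * R * \<beta>\<^sub>1 - q * R) = 0"
    using J\<^sub>1[of 1] by (simp add: Q Z P algebra_simps)
  then have A: "a * \<beta>\<^sub>1 - 2 * a * q + 2 * R * \<beta>\<^sub>1 - q * R = 0" using k(1) by simp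
  have "k * (a * \<beta>\<^sub>1 + a * q + 2 * R * \<beta>\<^sub>1 - q * R) = 0"
    using J\<^sub>3[of 3] by (simp add: Q Z P algebra_simps)
  then have B: "a * \<beta>\<^sub>1 + a * q + 2 * R * \<beta>\<^sub>1 - q * R = 0" using k(1) by simp
  have "a * q = 0" using A B by linarith
  moreover have "(a + 2 * R) * \<beta>\<^sub>1 = q * (R - a)" using B by (simp add: algebra_simps)
  ultimately have q: "q = 0" "\<beta>\<^sub>1 = 0" using a R by auto
  have "R * s = 0" using J\<^sub>2[of 2] by (simp add: Q Z P q algebra_simps)
  then have s: "s = 0" using a R by auto
  have 3: "- a * \<beta>\<^sub>2 + a * p - a * r + \<beta>\<^sub>2 * R - r * R = 0"
    using J\<^sub>1[of 2] by (simp add: Q Z P q s algebra_simps)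
  have "k * (a * \<beta>\<^sub>2 + a * p - a * r + \<beta>\<^sub>2 * R + p * R - r * R) = 0"
    using J\<^sub>2[of 1] by (simp add: Q Z P q s algebra_simps)
  then have 4: "a * \<beta>\<^sub>2 + a * p - a * r + \<beta>\<^sub>2 * R + p * R - r * R = 0" using k(1) by simp
  have "k * (a * \<beta>\<^sub>2 - a * r - \<beta>\<^sub>2 * R + r * R) = 0"
    using J\<^sub>4[of 3] by (simp add: Q Z P q s algebra_simps)
  then have 5: "a * \<beta>\<^sub>2 - a * r - \<beta>\<^sub>2 * R + r * R = 0" using k(1) by simp
  note bl = bilinear_expand[OF lie_algebraD(1)[OF br]] lie_algebraD(2)[OF br]
  note B = b[unfolded \<alpha> \<phi>_def comb_def, folded a_def, simplified]
  note anti = lie_algebraD(3)[OF br, of v\<^sub>2 v\<^sub>1] lie_algebraD(3)[OF br, of "J v\<^sub>2" "J v\<^sub>1"]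
    lie_algebraD(3)[OF br, of "J v\<^sub>1" v\<^sub>1] lie_algebraD(3)[OF br, of "J v\<^sub>2" v\<^sub>1]
    lie_algebraD(3)[OF br, of "J v\<^sub>1" v\<^sub>2] lie_algebraD(3)[OF br, of "J v\<^sub>2" v\<^sub>2]
  from R show ?thesis
  proof
    assume R: "R = a"
    have "a * (p - 2 * r) = 0" "a * (\<beta>\<^sub>2 + p - r) = 0" using 3 4 by (simp_all add: R algebra_simps)
    then have p: "p = 2 * r" "\<beta>\<^sub>2 = - r" using a by simp_all
    note B = B[unfolded Q Z P q s p R, simplified]
    \<comment> \<open>\<open>e\<^sub>3\<close> is \<open>[v\<^sub>2, J v\<^sub>2]\<close>.\<close>
    define e\<^sub>3 e\<^sub>4 where "e\<^sub>3 = (- 2 * k * r) *\<^sub>R v\<^sub>1 + (- 2 * k * a) *\<^sub>R J v\<^sub>1" and "e\<^sub>4 = (- 1 / (2 * a)) *\<^sub>R v\<^sub>1"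
    have "frame v\<^sub>2 (J v\<^sub>2) e\<^sub>3 e\<^sub>4"
    proof (rule frameI)
      fix x y z w
      assume "x *\<^sub>R v\<^sub>2 + y *\<^sub>R J v\<^sub>2 + z *\<^sub>R e\<^sub>3 + w *\<^sub>R e\<^sub>4 = 0"
      then have "(z * (- 2 * k * r) + w * (- 1 / (2 * a))) *\<^sub>R v\<^sub>1 + x *\<^sub>R v\<^sub>2 + (z * (- 2 * k * a)) *\<^sub>R J v\<^sub>1 + y *\<^sub>R J v\<^sub>2 = 0"
        by (simp add: e\<^sub>3_def e\<^sub>4_def algebra_simps)
      from frameD[OF fr this] show "x = 0 \<and> y = 0 \<and> z = 0 \<and> w = 0" using a k(1) by simp
    qed
    from lie_isomorphic_d4halfI[OF br this dim] have "lie_isomorphic br d4half"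
      using a by (simp add: e\<^sub>3_def e\<^sub>4_def bl B anti scaleR_twice algebra_simps)
    then show ?thesis ..
  next
    assume R: "R = - a"
    have "2 * a * (\<beta>\<^sub>2 - r) = 0" "a * (p - 2 * \<beta>\<^sub>2) = 0" using 3 5 by (simp_all add: R algebra_simps)
    then have p: "p = 2 * r" "\<beta>\<^sub>2 = r" using a by simp_all
    note B = B[unfolded Q Z P q s p R, simplified]
    \<comment> \<open>\<open>e\<^sub>1\<close> is \<open>[v\<^sub>1, J v\<^sub>1] / 2\<close>, an eigenvector of weight 2 of \<open>ad e\<^sub>4\<close>, and \<open>e\<^sub>3\<close> is
      \<open>[e\<^sub>1, v\<^sub>2]\<close>.\<close>
    define e\<^sub>1 e\<^sub>3 e\<^sub>4 where "e\<^sub>1 = a *\<^sub>R J v\<^sub>1 - r *\<^sub>R v\<^sub>1" and "e\<^sub>3 = (2 * a * r) *\<^sub>R v\<^sub>2 - (2 * a * a) *\<^sub>R J v\<^sub>2"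
      and "e\<^sub>4 = (1 / a) *\<^sub>R v\<^sub>1"
    have "frame e\<^sub>1 v\<^sub>2 e\<^sub>3 e\<^sub>4"
    proof (rule frameI)
      fix x y z w
      assume "x *\<^sub>R e\<^sub>1 + y *\<^sub>R v\<^sub>2 + z *\<^sub>R e\<^sub>3 + w *\<^sub>R e\<^sub>4 = 0"
      then have "(w * (1 / a) - x * r) *\<^sub>R v\<^sub>1 + (y + z * (2 * a * r)) *\<^sub>R v\<^sub>2 + (x * a) *\<^sub>R J v\<^sub>1 + (- z * (2 * a * a)) *\<^sub>R J v\<^sub>2 = 0"
        by (simp add: e\<^sub>1_def e\<^sub>3_def e\<^sub>4_def algebra_simps)
      from frameD[OF fr this] show "x = 0 \<and> y = 0 \<and> z = 0 \<and> w = 0" using a by simp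
    qed
    from lie_isomorphic_d42I[OF br this dim] have "lie_isomorphic br d42"
      using a by (simp add: e\<^sub>1_def e\<^sub>3_def e\<^sub>4_def bl B anti scaleR_twice algebra_simps)
    then show ?thesis ..
  qed
qed

text \<open>Now \<open>\<alpha>\<^sub>2 = 0\<close> and \<open>\<alpha>\<^sub>1 = - l = a\<close>, and the equations kill everything except \<open>p\<close>, \<open>P\<close> and
  \<open>\<beta>\<^sub>1\<close>.  The result is a semidirect product of a line with an abelian ideal on which \<open>v\<^sub>1 / a\<close> has the
  eigenvalues \<open>1, -1, -1\<close>; the eigenvector \<open>e\<^sub>1\<close> for \<open>1\<close> corrects \<open>[v\<^sub>1, J v\<^sub>1]\<close> by \<open>v\<^sub>2\<close> and \<open>J v\<^sub>2\<close>.\<close>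

lemma isotropic_leaf_case:
  assumes fr: "frame v\<^sub>1 v\<^sub>2 (J v\<^sub>1) (J v\<^sub>2)" and v: "v\<^sub>1 \<in> V" "v\<^sub>2 \<in> V"
    and iso: "h v\<^sub>1 v\<^sub>1 = 0" "h v\<^sub>2 v\<^sub>2 = 0" and nz: "h v\<^sub>1 v\<^sub>2 \<noteq> 0"
    and l: "br v\<^sub>1 v\<^sub>2 = l *\<^sub>R v\<^sub>2" "l \<noteq> 0"
  shows "lie_isomorphic br r4m1m1"
proof -
  define \<phi> where "\<phi> = comb v\<^sub>1 v\<^sub>2 (J v\<^sub>1) (J v\<^sub>2)"
  obtain \<alpha>\<^sub>1 \<alpha>\<^sub>2 \<beta>\<^sub>1 \<beta>\<^sub>2 p q r s P Q R Z where b: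
    "br v\<^sub>1 v\<^sub>2 = \<phi> (vector [- \<alpha>\<^sub>2, - \<alpha>\<^sub>1, 0, 0])"
    "br v\<^sub>1 (J v\<^sub>1) = \<phi> (vector [- q - \<beta>\<^sub>1, - p, \<alpha>\<^sub>1 - Q, - P])"
    "br v\<^sub>1 (J v\<^sub>2) = \<phi> (vector [- r - \<beta>\<^sub>2, - q, - R, - Q - \<alpha>\<^sub>1])"
    "br v\<^sub>2 (J v\<^sub>1) = \<phi> (vector [- r, \<beta>\<^sub>1 - q, \<alpha>\<^sub>2 - R, - Q])"
    "br v\<^sub>2 (J v\<^sub>2) = \<phi> (vector [- s, \<beta>\<^sub>2 - r, - Z, - R - \<alpha>\<^sub>2])"
    "br (J v\<^sub>1) (J v\<^sub>2) = \<phi> (vector [0, 0, - \<beta>\<^sub>2, - \<beta>\<^sub>1])"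
    by (rule isotropic_frame_brackets[OF fr v iso nz, folded \<phi>_def]) blast
  have "(- \<alpha>\<^sub>2) *\<^sub>R v\<^sub>1 + (- \<alpha>\<^sub>1 - l) *\<^sub>R v\<^sub>2 + 0 *\<^sub>R J v\<^sub>1 + 0 *\<^sub>R J v\<^sub>2 = 0"
    using b(1) l(1) by (simp add: \<phi>_def comb_def algebra_simps)
  from frameD(1,2)[OF fr this] have \<alpha>: "\<alpha>\<^sub>2 = 0" "\<alpha>\<^sub>1 = - l" by simp_all
  define a where "a = - l"
  have a: "a \<noteq> 0" using l(2) by (simp add: a_def)
  note b = b[unfolded \<alpha>, folded a_def]
  note jac = jacobi_coordinates[OF br fr b[unfolded \<phi>_def]]
  note J\<^sub>1 = arg_cong[OF jac(1), of "\<lambda>x. x$_"] and J\<^sub>2 = arg_cong[OF jac(2), of "\<lambda>x. x$_"]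
    and J\<^sub>3 = arg_cong[OF jac(3), of "\<lambda>x. x$_"] and J\<^sub>4 = arg_cong[OF jac(4), of "\<lambda>x. x$_"]
  have "a * Q = 0" using J\<^sub>1[of 4] by (simp add: algebra_simps)
  then have Q: "Q = 0" using a by simp
  have "a * Z = 0" using J\<^sub>2[of 3] by (simp add: algebra_simps)
  then have Z: "Z = 0" using a by simp
  have "a * R = 0" using J\<^sub>1[of 3] J\<^sub>2[of 4] by (simp add: Q Z algebra_simps)
  then have R: "R = 0" using a by simp
  have "a * \<beta>\<^sub>2 = 0" using J\<^sub>2[of 2] J\<^sub>3[of 3] by (simp add: Q Z R algebra_simps)
  then have \<beta>\<^sub>2: "\<beta>\<^sub>2 = 0" using a by simp
  have "a * r = 0" using J\<^sub>2[of 2] J\<^sub>3[of 3] by (simp add: Q Z R \<beta>\<^sub>2 algebra_simps)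
  then have r: "r = 0" "\<beta>\<^sub>2 = 0" using a \<beta>\<^sub>2 by simp_all
  have "a * q = 0" using J\<^sub>1[of 2] by (simp add: Q Z R r algebra_simps)
  then have q: "q = 0" using a by simp
  have "a * s = 0" using J\<^sub>2[of 1] by (simp add: Q Z R r q algebra_simps)
  then have s: "s = 0" using a by simp
  note bl = bilinear_expand[OF lie_algebraD(1)[OF br]] lie_algebraD(2)[OF br]
  note B = b[unfolded Q Z R r q s \<phi>_def comb_def, simplified]
  note anti = lie_algebraD(3)[OF br, of v\<^sub>2 v\<^sub>1] lie_algebraD(3)[OF br, of "J v\<^sub>2" "J v\<^sub>1"]
    lie_algebraD(3)[OF br, of "J v\<^sub>1" v\<^sub>1] lie_algebraD(3)[OF br, of "J v\<^sub>2" v\<^sub>1]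
    lie_algebraD(3)[OF br, of "J v\<^sub>1" v\<^sub>2] lie_algebraD(3)[OF br, of "J v\<^sub>2" v\<^sub>2]
  define p' P' where "p' = p / 2" and "P' = P / 2"
  then have p: "p = p' * 2" "P = P' * 2" by simp_all
  define e\<^sub>1 e\<^sub>4 where "e\<^sub>1 = a *\<^sub>R J v\<^sub>1 - \<beta>\<^sub>1 *\<^sub>R v\<^sub>1 - P' *\<^sub>R J v\<^sub>2 - p' *\<^sub>R v\<^sub>2" and "e\<^sub>4 = (1 / a) *\<^sub>R v\<^sub>1"
  have "frame e\<^sub>1 v\<^sub>2 (J v\<^sub>2) e\<^sub>4"
  proof (rule frameI)
    fix x y z w
    assume "x *\<^sub>R e\<^sub>1 + y *\<^sub>R v\<^sub>2 + z *\<^sub>R J v\<^sub>2 + w *\<^sub>R e\<^sub>4 = 0"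
    then have "(w * (1 / a) - x * \<beta>\<^sub>1) *\<^sub>R v\<^sub>1 + (y - x * p') *\<^sub>R v\<^sub>2 + (x * a) *\<^sub>R J v\<^sub>1 + (z - x * P') *\<^sub>R J v\<^sub>2 = 0"
      by (simp add: e\<^sub>1_def e\<^sub>4_def algebra_simps)
    from frameD[OF fr this] show "x = 0 \<and> y = 0 \<and> z = 0 \<and> w = 0" using a by simp
  qed
  from lie_isomorphic_r4m1m1I[OF br this dim] show ?thesis
    using a by (simp add: e\<^sub>1_def e\<^sub>4_def bl B p anti scaleR_twice algebra_simps)
qed

text \<open>A nonzero bracket \<open>c\<close> of two vectors of \<open>V\<close> spans the derived ideal of this plane, so
  \<open>[v,c]\<close> is a nonzero multiple of \<open>c\<close> for every \<open>v\<close> in \<open>V\<close> independent of \<open>c\<close>.  The norm of \<open>c\<close>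
  decides between the two kinds of frames.\<close>

lemma nonabelian_leaf_cases:
  assumes "u\<^sub>1 \<in> V" "u\<^sub>2 \<in> V" "br u\<^sub>1 u\<^sub>2 \<noteq> 0"
  shows "lie_isomorphic br r4m1m1 \<or> lie_isomorphic br d42 \<or> lie_isomorphic br d4half"
proof -
  define c where "c = br u\<^sub>1 u\<^sub>2"
  have c: "c \<in> V" "c \<noteq> 0" using assms V(2) by (simp_all add: c_def)
  have eigen: "\<exists>l. l \<noteq> 0 \<and> br v c = l *\<^sub>R c" if fr: "frame v c (J v) (J c)" and v: "v \<in> V" for v
  proof -
    obtain w x y z where u: "u\<^sub>1 = w *\<^sub>R v + x *\<^sub>R c" "u\<^sub>2 = y *\<^sub>R v + z *\<^sub>R c"
      using leaf_span(1)[OF fr v c(1)] assms(1,2) by metis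
    define m where "m = w * z - x * y"
    have "br u\<^sub>1 u\<^sub>2 = m *\<^sub>R br v c"
      by (simp only: u) (simp add: m_def bilinear_expand[OF lie_algebraD(1)[OF br]] lie_algebraD(2)[OF br]
        lie_algebraD(3)[OF br, of c v] algebra_simps)
    then have "c = m *\<^sub>R br v c" by (simp only: c_def[symmetric])
    then have "m \<noteq> 0" "(1 / m) *\<^sub>R c = (1 / m) *\<^sub>R m *\<^sub>R br v c"
      using c(2) by (metis scaleR_zero_left, simp)
    then show ?thesis by (intro exI[of _ "1 / m"]) simp
  qed
  show ?thesis
  proof (cases "h c c = 0")
    case True
    obtain v where v: "v \<in> V" "h v c \<noteq> 0" "h v v = 0" "frame v c (J v) (J c)"
      using isotropic_leaf_basis[OF c True] by blast
    obtain l where "l \<noteq> 0" "br v c = l *\<^sub>R c" using eigen v by blast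
    then show ?thesis using isotropic_leaf_case[OF v(4,1) c(1) v(3) True v(2)] by blast
  next
    case False
    obtain v where v: "v \<in> V" "h v c = 0" "h v v \<noteq> 0" "frame v c (J v) (J c)"
      using orthogonal_leaf_basis[OF c(1) False] by blast
    obtain l where "l \<noteq> 0" "br v c = l *\<^sub>R c" using eigen v by blast
    then show ?thesis using orthogonal_leaf_cases[OF v(4,1) c(1) v(2,3) False] by blast
  qed
qed

lemma isomorphic_to_listed:
  assumes "\<not> abelian_lie br"
  shows "lie_isomorphic br rh3 \<or> lie_isomorphic br rr30 \<or> lie_isomorphic br r2r2 \<or>
     lie_isomorphic br r2' \<or> lie_isomorphic br r4m1m1 \<or> lie_isomorphic br d41 \<or>
     lie_isomorphic br d42 \<or> lie_isomorphic br d4half"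
proof (cases "\<forall>x\<in>V. \<forall>y\<in>V. br x y = 0")
  case True
  then have V: "br x y = 0" if "x \<in> V" "y \<in> V" for x y using that by blast
  show ?thesis
  proof (cases "\<forall>x\<in>W. \<forall>y\<in>W. br x y = 0")
    case True
    then have W: "br x y = 0" if "x \<in> W" "y \<in> W" for x y using that by blast
    have "lie_isomorphic br rh3 \<or> lie_isomorphic br rr30 \<or> lie_isomorphic br r2r2 \<or>
      lie_isomorphic br r2' \<or> lie_isomorphic br d41"
      by (rule abelian_leaves_cases[OF assms]) (fact V W)+
    then show ?thesis by argo
  next
    case False
    then obtain x y where "x \<in> W" "y \<in> W" "br x y \<noteq> 0" by blast
    from born_lie_algebra.nonabelian_leaf_cases[OF swap this] show ?thesis by argo
  qed
next
  case False
  then obtain x y where "x \<in> V" "y \<in> V" "br x y \<noteq> 0" by blast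
  from nonabelian_leaf_cases[OF this] show ?thesis by argo
qed

end

text \<open>The preceding analysis takes place in a Euclidean space; an arbitrary four-dimensional real vector
  space is brought to \<open>\<real>\<^sup>4\<close> by transporting the bracket along a linear bijection.\<close>

lemma integrable_born_imp_listed:
  fixes br :: "'a::real_vector \<Rightarrow> 'a \<Rightarrow> 'a"
  assumes br: "lie_algebra br" and dim: "dim (UNIV :: 'a set) = 4" and nonab: "\<not> abelian_lie br"
    and born: "integrable_born_structure br g h \<omega>"
  shows "lie_isomorphic br rh3 \<or> lie_isomorphic br rr30 \<or> lie_isomorphic br r2r2 \<or>
     lie_isomorphic br r2' \<or> lie_isomorphic br r4m1m1 \<or> lie_isomorphic br d41 \<or>
     lie_isomorphic br d42 \<or> lie_isomorphic br d4half"
proof -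
  obtain f :: "'a \<Rightarrow> real^4" where f: "linear f" "bij f" using ex_linear_bij_real4[OF dim] by blast
  have inv: "f (inv f y) = y" "inv f (f x) = x" for x y
    using f(2) by (simp_all add: bij_def surj_f_inv_f)
  have lin_inv: "linear (inv f)" by (rule linear_inv[OF f(1,2)])
  define br' where "br' x y = f (br (inv f x) (inv f y))" for x y
  have iso: "lie_isomorphic br br'"
    unfolding lie_isomorphic_def using f by (intro exI[of _ f]) (simp add: br'_def inv)
  note f_simps = linear_add[OF f(1)] linear_scale[OF f(1)] linear_0[OF f(1)]
    linear_add[OF lin_inv] linear_scale[OF lin_inv] inv
  have br': "lie_algebra br'"
  proof -
    have "bilinear br'"
      unfolding bilinear_def
      by (simp add: linear_iff br'_def f_simps bilinear_expand[OF lie_algebraD(1)[OF br]])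
    moreover have "br' x (br' y z) + br' y (br' z x) + br' z (br' x y) = 0" for x y z
    proof -
      let ?x = "inv f x" and ?y = "inv f y" and ?z = "inv f z"
      have "br' x (br' y z) + br' y (br' z x) + br' z (br' x y)
          = f (br ?x (br ?y ?z) + br ?y (br ?z ?x) + br ?z (br ?x ?y))"
        by (simp add: br'_def f_simps)
      then show ?thesis by (simp only: lie_algebraD(4)[OF br] f_simps)
    qed
    ultimately show ?thesis
      unfolding lie_algebra_def by (simp add: br'_def lie_algebraD(2)[OF br] f_simps)
  qed
  have nonab': "\<not> abelian_lie br'"
  proof
    assume "abelian_lie br'"
    then have "br' (f x) (f y) = f 0" for x y by (simp add: abelian_lie_def f_simps)
    then have "br x y = 0" for x y using f(2) by (simp add: br'_def inv bij_def inj_eq)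
    with nonab show False by (simp add: abelian_lie_def)
  qed
  obtain g' h' \<omega>' where "integrable_born_structure br' g' h' \<omega>'"
    using integrable_born_structure_isomorphic[OF lie_isomorphic_sym[OF iso] born] by blast
  then have "\<exists>g \<omega>. integrable_born_structure br' g h' \<omega>" by blast
  then obtain J V W where "born_splitting h' J V W"
      "\<forall>x y z. ce_differential br' (\<lambda>x y. h' (J x) y) x y z = 0"
      "\<forall>x y. nijenhuis br' J x y = 0" "lie_subalgebra br' V" "lie_subalgebra br' W"
    unfolding integrable_born_structure_iff_splitting by (elim exE conjE)
  then have "born_lie_algebra br' h' J V W"
    using br' by (intro born_lie_algebra.intro) simp_all
  from born_lie_algebra.isomorphic_to_listed[OF this nonab'] show ?thesis
    using lie_isomorphic_trans[OF iso] by blast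
qed

section \<open>Born structures on the listed algebras\<close>

text \<open>The model splitting has \<open>V\<close> spanned by \<open>e\<^sub>i\<close>, \<open>e\<^sub>k\<close> and \<open>W\<close> by \<open>e\<^sub>j\<close>, \<open>e\<^sub>l\<close>, with \<open>J e\<^sub>i = e\<^sub>j\<close> and
  \<open>J e\<^sub>k = \<mu> e\<^sub>l\<close>.\<close>

definition model_J :: "4 \<Rightarrow> 4 \<Rightarrow> 4 \<Rightarrow> 4 \<Rightarrow> real \<Rightarrow> real^4 \<Rightarrow> real^4" where
  "model_J i j k l \<mu> x = x$i *\<^sub>R basis_vec j - x$j *\<^sub>R basis_vec i
     + (\<mu> * x$k) *\<^sub>R basis_vec l - (x$l / \<mu>) *\<^sub>R basis_vec k"

text \<open>The metric for which \<open>V\<close> and \<open>W\<close> are orthogonal, \<open>J\<close> is an isometry, and \<open>V\<close> has the Gram matrix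
  with entries \<open>E\<close>, \<open>F\<close>, \<open>G\<close> in the basis \<open>e\<^sub>i\<close>, \<open>e\<^sub>k\<close>.\<close>

definition model_h :: "4 \<Rightarrow> 4 \<Rightarrow> 4 \<Rightarrow> 4 \<Rightarrow> real \<Rightarrow> real \<Rightarrow> real \<Rightarrow> real \<Rightarrow> real^4 \<Rightarrow> real^4 \<Rightarrow> real" where
  "model_h i j k l \<mu> E F G x y =
     E * (x$i * y$i + x$j * y$j) + F * (x$i * y$k + x$k * y$i + (x$j * y$l + x$l * y$j) / \<mu>)
     + G * (x$k * y$k + x$l * y$l / (\<mu> * \<mu>))"

lemma model_integrable:
  fixes br :: "real^4 \<Rightarrow> real^4 \<Rightarrow> real^4"
  assumes dist: "distinct [i, j, k, l]" and \<mu>: "\<mu> \<noteq> 0" and nd: "E * G - F * F \<noteq> 0"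
    and closed: "\<And>x y z. ce_differential br (\<lambda>x y. model_h i j k l \<mu> E F G (model_J i j k l \<mu> x) y) x y z = 0"
    and nij: "\<And>x y. nijenhuis br (model_J i j k l \<mu>) x y = 0"
    and subV: "\<And>x y. \<lbrakk>x$j = 0; x$l = 0; y$j = 0; y$l = 0\<rbrakk> \<Longrightarrow> br x y $ j = 0 \<and> br x y $ l = 0"
    and subW: "\<And>x y. \<lbrakk>x$i = 0; x$k = 0; y$i = 0; y$k = 0\<rbrakk> \<Longrightarrow> br x y $ i = 0 \<and> br x y $ k = 0"
  shows "\<exists>g h \<omega>. integrable_born_structure br g h \<omega>"
proof -
  define J h where "J = model_J i j k l \<mu>" and "h = model_h i j k l \<mu> E F G"
  define V W where "V = {x :: real^4. x$j = 0 \<and> x$l = 0}" and "W = {x :: real^4. x$i = 0 \<and> x$k = 0}"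
  have ne: "i \<noteq> j" "i \<noteq> k" "i \<noteq> l" "j \<noteq> k" "j \<noteq> l" "k \<noteq> l" using dist by auto
  note ne = ne ne[symmetric]
  have "{i, j, k, l} = UNIV"
    using ne by (intro card_subset_eq) simp_all
  then have all: "t = i \<or> t = j \<or> t = k \<or> t = l" for t by blast
  have eq_iff: "x = y \<longleftrightarrow> x$i = y$i \<and> x$j = y$j \<and> x$k = y$k \<and> x$l = y$l" for x y :: "real^4"
    unfolding vec_eq_iff using all by (metis (no_types))
  have Jc: "J x $ i = - x$j" "J x $ j = x$i" "J x $ k = - x$l / \<mu>" "J x $ l = \<mu> * x$k" for x
    using ne by (simp_all add: J_def model_J_def basis_vec_def axis_def)
  have bil: "bilinear h"
    unfolding bilinear_def linear_iff h_def model_h_def by (simp add: field_simps \<mu>)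
  have sym: "h x y = h y x" for x y by (simp add: h_def model_h_def field_simps)
  have JJ: "J (J x) = - x" for x by (simp add: eq_iff Jc \<mu>)
  have hJ: "h (J x) (J y) = h x y" for x y
    by (simp add: h_def model_h_def Jc[unfolded J_def] flip: J_def) (simp add: field_simps \<mu> Jc)
  have zero: "x = 0" if *: "\<And>y. h x y = 0" for x
  proof -
    \<comment> \<open>Pairing with the four basis vectors gives one \<open>2 \<times> 2\<close> system on each leaf.\<close>
    have "E * x$i + F * x$k = 0" "F * x$i + G * x$k = 0" "E * x$j + F * (x$l / \<mu>) = 0" "F * x$j + G * (x$l / \<mu>) = 0"
      using *[of "basis_vec i"] *[of "basis_vec k"] *[of "basis_vec j"] *[of "basis_vec l"] ne \<mu>
      by (simp_all add: h_def model_h_def basis_vec_def axis_def field_simps)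
    then have "(E * G - F * F) * x$i = 0" "(E * G - F * F) * x$k = 0" "(E * G - F * F) * x$j = 0"
        "(E * G - F * F) * (x$l / \<mu>) = 0"
      by algebra+
    then show ?thesis using nd \<mu> by (simp add: eq_iff)
  qed
  have "nondegenerate h" unfolding nondegenerate_def using zero sym by metis
  then have "pseudo_metric h" using bil sym unfolding pseudo_metric_def by blast
  moreover have "linear J" by (rule linearI) (simp_all add: eq_iff Jc field_simps \<mu>)
  moreover have V: "subspace V" and W: "subspace W" by (auto simp: V_def W_def subspace_def)
  moreover have "V \<inter> W = {0}" by (auto simp: V_def W_def eq_iff)
  moreover have "\<forall>x. \<exists>v\<in>V. \<exists>w\<in>W. x = v + w"
  proof
    fix x
    show "\<exists>v\<in>V. \<exists>w\<in>W. x = v + w"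
      using ne by (intro bexI[of _ "x$i *\<^sub>R basis_vec i + x$k *\<^sub>R basis_vec k"]
          bexI[of _ "x$j *\<^sub>R basis_vec j + x$l *\<^sub>R basis_vec l"])
        (auto simp: V_def W_def eq_iff basis_vec_def axis_def)
  qed
  moreover have "\<forall>v\<in>V. \<forall>w\<in>W. h v w = 0" by (simp add: V_def W_def h_def model_h_def)
  moreover have "J ` V = W"
  proof -
    have "x = J (- J x)" "x \<in> W \<Longrightarrow> - J x \<in> V" "x \<in> V \<Longrightarrow> J x \<in> W" for x
      by (simp_all add: V_def W_def eq_iff Jc \<mu>)
    then show ?thesis by blast
  qed
  moreover have "J ` W = V"
  proof -
    have "x = J (- J x)" "x \<in> V \<Longrightarrow> - J x \<in> W" "x \<in> W \<Longrightarrow> J x \<in> V" for x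
      by (simp_all add: V_def W_def eq_iff Jc \<mu>)
    then show ?thesis by blast
  qed
  ultimately have "born_splitting h J V W"
    unfolding born_splitting_def by (intro conjI) (assumption | simp add: JJ hJ)+
  moreover have "lie_subalgebra br V" "lie_subalgebra br W"
    using V W subV subW unfolding lie_subalgebra_def by (simp_all add: V_def W_def)
  ultimately have "\<exists>g \<omega>. integrable_born_structure br g h \<omega>"
    using closed nij unfolding integrable_born_structure_iff_splitting J_def h_def by blast
  then show ?thesis by blast
qed

lemmas model_simps = model_J_def model_h_def listed_lie_defs wedge_def basis_vec_def axis_def
  ce_differential_def nijenhuis_def vec_eq_iff forall_4

text \<open>The indices and parameters come from the normal forms of the previous section.  For
  \<open>\<rr>\<hh>\<^sub>3\<close>, \<open>\<rr>\<rr>\<^bsub>3,0\<^esub>\<close>, \<open>\<rr>\<^sub>2\<rr>\<^sub>2\<close>, \<open>\<rr>'\<^sub>2\<close> and \<open>\<dd>\<^bsub>4,1\<^esub>\<close> the leaf is the algebra \<open>K\<close> with a metric for which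
  multiplication by \<open>M\<close> is self-adjoint: definite for \<open>\<real> \<times> \<real>\<close> in the basis of idempotents, the
  real part of the product for the complex numbers, and hyperbolic for the dual numbers.  The values
  for \<open>\<dd>\<^bsub>4,2\<^esub>\<close> and \<open>\<dd>\<^bsub>4,1/2\<^esub>\<close> are the solutions of \<open>orthogonal_leaf_cases\<close> with \<open>r = 0\<close>, and those
  for \<open>\<rr>\<^bsub>4,-1,-1\<^esub>\<close> the solution of \<open>isotropic_leaf_case\<close> with \<open>p = P = \<beta>\<^sub>1 = 0\<close>.\<close>

lemma rr30_born: "\<exists>g h \<omega>. integrable_born_structure rr30 g h \<omega>"
  by (rule model_integrable[of 1 2 3 4 1 1 1 0]) (simp_all add: model_simps algebra_simps)

lemma r2r2_born: "\<exists>g h \<omega>. integrable_born_structure r2r2 g h \<omega>"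
  by (rule model_integrable[of 1 2 3 4 1 1 1 0]) (simp_all add: model_simps algebra_simps)

lemma r2'_born: "\<exists>g h \<omega>. integrable_born_structure r2' g h \<omega>"
  by (rule model_integrable[of 1 3 2 4 1 1 "-1" 0]) (simp_all add: model_simps algebra_simps)

lemma d41_born: "\<exists>g h \<omega>. integrable_born_structure d41 g h \<omega>"
  by (rule model_integrable[of 4 1 2 3 "-1" 0 0 1]) (simp_all add: model_simps algebra_simps)

lemma rh3_born: "\<exists>g h \<omega>. integrable_born_structure rh3 g h \<omega>"
  by (rule model_integrable[of 1 2 4 3 1 0 0 1]) (simp_all add: model_simps algebra_simps)

lemma r4m1m1_born: "\<exists>g h \<omega>. integrable_born_structure r4m1m1 g h \<omega>"
  by (rule model_integrable[of 4 1 2 3 1 0 0 1]) (simp_all add: model_simps algebra_simps)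

lemma d42_born: "\<exists>g h \<omega>. integrable_born_structure d42 g h \<omega>"
  by (rule model_integrable[of 4 1 2 3 "-1/2" 1 1 0]) (simp_all add: model_simps algebra_simps)

lemma d4half_born: "\<exists>g h \<omega>. integrable_born_structure d4half g h \<omega>"
  by (rule model_integrable[of 4 3 1 2 1 1 1 0]) (simp_all add: model_simps algebra_simps)

section \<open>The classification\<close>

theorem theorem4p1:
  fixes br :: "'a::real_vector \<Rightarrow> 'a \<Rightarrow> 'a"
  assumes "lie_algebra br"
    and "dim (UNIV :: 'a set) = 4"
    and "\<not> abelian_lie br"
  shows "(\<exists>g h \<omega>. integrable_born_structure br g h \<omega>) \<longleftrightarrow>
     lie_isomorphic br rh3 \<or> lie_isomorphic br rr30 \<or> lie_isomorphic br r2r2 \<or>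
     lie_isomorphic br r2' \<or> lie_isomorphic br r4m1m1 \<or> lie_isomorphic br d41 \<or>
     lie_isomorphic br d42 \<or> lie_isomorphic br d4half"
  (is "?born \<longleftrightarrow> ?listed")
proof
  assume ?born
  then show ?listed using integrable_born_imp_listed[OF assms] by blast
next
  have transfer: ?born if "lie_isomorphic br br'" "\<exists>g h \<omega>. integrable_born_structure br' g h \<omega>"
    for br' :: "real^4 \<Rightarrow> real^4 \<Rightarrow> real^4"
    using integrable_born_structure_isomorphic[OF that(1)] that(2) by blast
  assume ?listed
  then show ?born
    by (elim disjE) (erule transfer, rule rh3_born rr30_born r2r2_born r2'_born r4m1m1_born d41_born
      d42_born d4half_born)+
qed

end
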